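(* Let $\rho$ be a probability measure on $\mathbb{R}$ having a density $f$ (with respect to Lebesgue measure) which satisfies: (a) $f$ is even; (b) there exists $v_0>0$ such that $\int_{\mathbb{R}} e^{v_0z^2}f(z)\,dz<+\infty$; (c) there exists $p\in\,]1,2]$ such that $$\int_{\mathbb{R}^2} f^p(x+y)f^p(y)|x|^{1-p}\,dx\,dy<+\infty.$$ Let $\sigma^2$ be the variance of $\rho$ and let $\mu_4$ be the fourth moment of $\rho$. Then, under $\tilde\mu_{n,\rho}$, as $n\to\infty$, the random variable $$\frac{\mu_4^{1/4}S_n}{\sigma^2n^{3/4}}$$ converges in distribution to the probability law on $\mathbb{R}$ with density $$s\longmapsto\Big(\frac43\Big)^{1/4}\Gamma\Big(\frac14\Big)^{-1}\exp\Big(-\frac{s^4}{12}\Big).$$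
   Context: For a probability measure $\rho$ on $\mathbb{R}$ that is not the Dirac mass at $0$ and $n\ge1$, $\tilde\mu_{n,\rho}$ denotes the probability measure on $\mathbb{R}^n$ given by $$d\tilde\mu_{n,\rho}(x_1,\ldots,x_n)=\frac1{Z_n}\exp\Big(\frac12\,\frac{(x_1+\cdots+x_n)^2}{x_1^2+\cdots+x_n^2}\Big)\mathbf 1_{\{x_1^2+\cdots+x_n^2>0\}}\prod_{i=1}^n d\rho(x_i),$$ where $Z_n$ is the normalizing constant. For each $n$, $(X_n^1,\ldots,X_n^n)$ is a random vector with law $\tilde\mu_{n,\rho}$, and $S_n=X_n^1+\cdots+X_n^n$. $\Gamma$ is the Gamma function; $]a,b]$ denotes the half-open interval; $f^p(x)=(f(x))^p$. *)

theory Defs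
  imports "HOL-Probability.Probability"
begin

text \<open>
  Vectors of \<open>\<real>\<^sup>n\<close> are the elements of the product space over the index set \<open>{..<n}\<close>.
\<close>

definition tilde_mu_weight :: "nat \<Rightarrow> (nat \<Rightarrow> real) \<Rightarrow> real" where
  "tilde_mu_weight n x =
     exp (1 / 2 * ((\<Sum>i<n. x i)\<^sup>2 / (\<Sum>i<n. (x i)\<^sup>2)))
       * indicator {y. (\<Sum>i<n. (y i)\<^sup>2) > 0} x"

definition tilde_mu_Z :: "nat \<Rightarrow> real measure \<Rightarrow> real" where
  "tilde_mu_Z n \<rho> = (\<integral>x. tilde_mu_weight n x \<partial>(\<Pi>\<^sub>M i\<in>{..<n}. \<rho>))"

text \<open>
  This is a probability measure when \<open>n \<ge> 1\<close> and \<open>\<rho>\<close> is a probability measure on the Borel sets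
  other than the Dirac mass at 0. For \<open>n = 0\<close> it is the null measure.
\<close>

definition tilde_mu :: "nat \<Rightarrow> real measure \<Rightarrow> (nat \<Rightarrow> real) measure" where
  "tilde_mu n \<rho> =
     density (\<Pi>\<^sub>M i\<in>{..<n}. \<rho>) (\<lambda>x. ennreal (1 / tilde_mu_Z n \<rho> * tilde_mu_weight n x))"

end

theory Submission
  imports Defs
begin

text \<open>
  Put \<open>v = E x\<^sup>2\<close>, \<open>m = E x\<^sup>4\<close>, \<open>S = \<Sum> x\<^sub>i\<close> and \<open>T = \<Sum> x\<^sub>i\<^sup>2\<close>. The weight \<open>exp (S\<^sup>2 / (2T))\<close> is the
  moment generating function of a standard Gaussian at \<open>r = S / \<surd>T\<close>, so it is linearised by an extra
  real variable \<open>u\<close>: up to a constant,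
  \<open>exp (r\<^sup>2 / 2) = \<integral> exp (\<lambda> u r - \<lambda>\<^sup>2 u\<^sup>2 / 2) du\<close>. The scale \<open>\<lambda>\<close> is chosen so that
  \<open>\<lambda>\<^sup>4 = n v\<^sup>2 / m\<close>. In other words, the law of the sample is the first marginal of a joint law under
  which \<open>u\<close>, given the sample, is Gaussian with mean \<open>r / \<lambda>\<close> and standard deviation \<open>1 / \<lambda>\<close>
  (\<open>mixed_weight_eq\<close>).

  The other marginal is accessible because the law is symmetric and \<open>T\<close> does not see the signs of the
  coordinates: averaging over signs replaces \<open>exp (\<lambda> u S / \<surd>T)\<close> by the product of the
  \<open>cosh t\<^sub>i\<close>, \<open>t\<^sub>i = \<lambda> u x\<^sub>i / \<surd>T\<close> (\<open>symmetrisation\<close>, \<open>mixture_swap\<close>). Self-normalisation makes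
  \<open>\<Sum> t\<^sub>i\<^sup>2 = \<lambda>\<^sup>2 u\<^sup>2\<close> hold exactly, so the quadratic term of \<open>ln cosh t = t\<^sup>2 / 2 - t\<^sup>4 / 12 + \<dots>\<close>
  cancels against the Gaussian factor. What is left is
  \<open>exp (- \<Sum> t\<^sub>i\<^sup>4 / 12 + \<dots>)\<close>, where
  \<open>\<Sum> t\<^sub>i\<^sup>4 = \<lambda>\<^sup>4 u\<^sup>4 \<Sum> x\<^sub>i\<^sup>4 / T\<^sup>2\<close> tends to \<open>u\<^sup>4\<close> by the law of large
  numbers. Hence the density of \<open>u\<close> is proportional to a function that tends to \<open>exp (- u\<^sup>4 / 12)\<close>
  (\<open>profile_tendsto\<close>). By convexity the product of the \<open>cosh t\<^sub>i\<close>, taken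
  together with the Gaussian factor, is bounded for every sample by a Gaussian in \<open>u\<close> whose width does not depend on \<open>n\<close> (\<open>cosh_weight_le_envelope\<close>), which gives
  convergence of all integrals and of the normalising constants.

  Finally the rescaled sum is \<open>(r / \<lambda>) \<surd>(T / (n v))\<close>. It differs from \<open>u\<close> by a Gaussian error of
  order \<open>1 / \<lambda>\<close> and by the factor \<open>\<surd>(T / (n v))\<close>, which is close to 1. For Lipschitz test
  functions this costs a vanishing amount (\<open>mixture_comparison\<close>), so the rescaled sum and \<open>u\<close> have the
  same limit law.
\<close>

section \<open>Inequalities for hyperbolic functions and sums\<close>

text \<open>
  Most of the following inequalities are equalities at 0 and follow by comparing derivatives. Since
  \<open>tanh' = 1 - tanh\<^sup>2\<close>, a lower bound for \<open>tanh\<close> yields an upper bound and conversely, and bounds for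
  \<open>tanh\<close> integrate to bounds for \<open>ln cosh\<close>.
\<close>

lemma nonneg_of_deriv_nonneg:
  fixes f f' :: "real \<Rightarrow> real"
  assumes "\<And>s. 0 \<le> s \<Longrightarrow> (f has_real_derivative f' s) (at s)"
    and "\<And>s. 0 \<le> s \<Longrightarrow> 0 \<le> f' s" and "f 0 = 0" and "0 \<le> t"
  shows "0 \<le> f t"
proof -
  have "f 0 \<le> f t"
    by (rule DERIV_nonneg_imp_nondecreasing[OF \<open>0 \<le> t\<close>]) (use assms in auto)
  with \<open>f 0 = 0\<close> show ?thesis by simp
qed

lemma tanh_le_self:
  fixes t :: real assumes "0 \<le> t" shows "tanh t \<le> t"
proof -
  have "0 \<le> t - tanh t"
    by (rule nonneg_of_deriv_nonneg[where f = "\<lambda>s. s - tanh s" and f' = "\<lambda>s. (tanh s)\<^sup>2"])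
       (use assms in \<open>auto intro!: derivative_eq_intros\<close>)
  then show ?thesis by simp
qed

lemma tanh_ge_cubic:
  fixes t :: real assumes "0 \<le> t" shows "t - t ^ 3 / 3 \<le> tanh t"
proof -
  have "0 \<le> tanh t - (t - t ^ 3 / 3)"
  proof (rule nonneg_of_deriv_nonneg[where f = "\<lambda>s. tanh s - (s - s ^ 3 / 3)"
        and f' = "\<lambda>s. s\<^sup>2 - (tanh s)\<^sup>2"])
    fix s :: real assume "0 \<le> s"
    then show "0 \<le> s\<^sup>2 - (tanh s)\<^sup>2" using tanh_le_self[of s] by (simp add: power_mono)
  qed (use assms in \<open>auto intro!: derivative_eq_intros\<close>)
  then show ?thesis by simp
qed

lemma tanh_le_quintic:
  fixes t :: real assumes "0 \<le> t" shows "tanh t \<le> t - t ^ 3 / 3 + 2 * t ^ 5 / 15"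
proof -
  have "0 \<le> t - t ^ 3 / 3 + 2 * t ^ 5 / 15 - tanh t"
  proof (rule nonneg_of_deriv_nonneg[where f = "\<lambda>s. s - s ^ 3 / 3 + 2 * s ^ 5 / 15 - tanh s"
        and f' = "\<lambda>s. (tanh s)\<^sup>2 - (s\<^sup>2 - 2 * s ^ 4 / 3)"])
    fix s :: real assume s: "0 \<le> s"
    have "s\<^sup>2 - 2 * s ^ 4 / 3 \<le> (tanh s)\<^sup>2"
    proof (cases "0 \<le> s - s ^ 3 / 3")
      case True
      have "(s - s ^ 3 / 3)\<^sup>2 = s\<^sup>2 - 2 * s ^ 4 / 3 + (s ^ 3 / 3)\<^sup>2"
        by (simp add: power2_eq_square power3_eq_cube power4_eq_xxxx algebra_simps)
      then have "s\<^sup>2 - 2 * s ^ 4 / 3 \<le> (s - s ^ 3 / 3)\<^sup>2" by simp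
      also have "\<dots> \<le> (tanh s)\<^sup>2"
        using True tanh_ge_cubic[OF s] by (intro power_mono) auto
      finally show ?thesis .
    next
      case False
      \<comment> \<open>Squaring the cubic lower bound is not allowed here, but the bound to be shown is then negative.\<close>
      then have "s * (1 - s\<^sup>2 / 3) < 0" by (simp add: algebra_simps power2_eq_square power3_eq_cube)
      then have "1 - s\<^sup>2 / 3 < 0" using s by (simp add: mult_less_0_iff)
      then have "s\<^sup>2 * (1 - 2 * s\<^sup>2 / 3) \<le> 0" by (intro mult_nonneg_nonpos) auto
      then have "s\<^sup>2 - 2 * s ^ 4 / 3 \<le> 0"
        by (simp add: algebra_simps power2_eq_square power4_eq_xxxx)
      then show ?thesis using zero_le_power2[of "tanh s"] by linarith
    qed
    then show "0 \<le> (tanh s)\<^sup>2 - (s\<^sup>2 - 2 * s ^ 4 / 3)" by simp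
  qed (use assms in \<open>auto intro!: derivative_eq_intros\<close>)
  then show ?thesis by simp
qed

lemma tanh_ge_rational:
  fixes t :: real assumes "0 \<le> t" shows "t / (1 + t) \<le> tanh t"
proof -
  have "1 + 2 * t \<le> exp (2 * t)" using exp_ge_add_one_self by simp
  moreover have "tanh t = 1 - 2 / (exp (2 * t) + 1)"
  proof -
    have "exp (2 * t) = exp t * exp t" by (simp flip: exp_add)
    moreover have "0 < exp t * exp t + 1" by (simp add: add_pos_pos)
    ultimately show ?thesis
      by (simp add: tanh_altdef exp_minus divide_simps add_eq_0_iff)
  qed
  moreover have "2 / (exp (2 * t) + 1) \<le> 2 / (2 + 2 * t)"
    using assms calculation(1) by (intro divide_left_mono mult_pos_pos add_pos_nonneg) auto
  moreover have "t / (1 + t) = 1 - 2 / (2 + 2 * t)"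
    using assms by (simp add: field_simps)
  ultimately show ?thesis by linarith
qed

text \<open>
  Unlike the polynomial bounds, this one is useful for all \<open>t\<close>: the deficit \<open>t - tanh t\<close> is of order
  \<open>t\<^sup>3\<close> near 0 and of order \<open>t\<close> at infinity.
\<close>

lemma tanh_le_rational:
  fixes t :: real assumes "0 \<le> t" shows "tanh t \<le> t - (t - t / (1 + t\<^sup>2)) / 6"
proof -
  have pos: "1 + s\<^sup>2 > 0" for s :: real by (simp add: add_pos_nonneg)
  have "0 \<le> t - (t - t / (1 + t\<^sup>2)) / 6 - tanh t"
  proof (rule nonneg_of_deriv_nonneg[where f = "\<lambda>s. s - (s - s / (1 + s\<^sup>2)) / 6 - tanh s"
        and f' = "\<lambda>s. (tanh s)\<^sup>2 - (1 - (1 - s\<^sup>2) / (1 + s\<^sup>2)\<^sup>2) / 6"])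
    fix s :: real assume s: "0 \<le> s"
    have "1 - (1 - s\<^sup>2) / (1 + s\<^sup>2)\<^sup>2 = s\<^sup>2 * (3 + s\<^sup>2) / (1 + s\<^sup>2)\<^sup>2"
      using pos[of s] by (simp add: divide_simps) (simp add: algebra_simps power2_eq_square)
    also have "\<dots> \<le> s\<^sup>2 * (3 * (1 + s\<^sup>2)) / (1 + s\<^sup>2)\<^sup>2"
      using pos[of s] by (intro divide_right_mono mult_left_mono) auto
    also have "\<dots> = 3 * s\<^sup>2 / (1 + s\<^sup>2)"
      using pos[of s] by (simp add: divide_simps) (simp add: power2_eq_square)
    also have "\<dots> \<le> 6 * (s\<^sup>2 / (1 + s)\<^sup>2)"
    proof -
      have "(1 + s)\<^sup>2 \<le> 2 * (1 + s\<^sup>2)"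
        using zero_le_power2[of "1 - s"] by (simp add: power2_eq_square algebra_simps)
      then have "s\<^sup>2 * (1 + s)\<^sup>2 \<le> s\<^sup>2 * (2 * (1 + s\<^sup>2))" by (intro mult_left_mono) auto
      then show ?thesis
        using pos[of s] s by (simp add: field_simps)
    qed
    also have "\<dots> \<le> 6 * (tanh s)\<^sup>2"
      using tanh_ge_rational[OF s] s
      by (simp add: power_divide[symmetric] power_mono)
    finally show "0 \<le> (tanh s)\<^sup>2 - (1 - (1 - s\<^sup>2) / (1 + s\<^sup>2)\<^sup>2) / 6" by simp
  next
    fix s :: real
    have "(1 + s\<^sup>2 - s * (2 * s)) = 1 - s\<^sup>2" by (simp add: power2_eq_square)
    then show "((\<lambda>s. s - (s - s / (1 + s\<^sup>2)) / 6 - tanh s) has_real_derivative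
         (tanh s)\<^sup>2 - (1 - (1 - s\<^sup>2) / (1 + s\<^sup>2)\<^sup>2) / 6) (at s)"
      using pos[of s] by (auto intro!: derivative_eq_intros simp: power2_eq_square)
  qed (use assms in auto)
  then show ?thesis by simp
qed

lemma ln_cosh_ge: "t\<^sup>2 / 2 - t ^ 4 / 12 \<le> ln (cosh (t :: real))"
proof -
  have "0 \<le> ln (cosh s) - (s\<^sup>2 / 2 - s ^ 4 / 12)" if "0 \<le> s" for s :: real
  proof (rule nonneg_of_deriv_nonneg[where f = "\<lambda>s. ln (cosh s) - (s\<^sup>2 / 2 - s ^ 4 / 12)"
        and f' = "\<lambda>s. tanh s - (s - s ^ 3 / 3)"])
    fix s :: real
    show "((\<lambda>s. ln (cosh s) - (s\<^sup>2 / 2 - s ^ 4 / 12)) has_real_derivative tanh s - (s - s ^ 3 / 3)) (at s)"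
      by (auto intro!: derivative_eq_intros simp: tanh_def field_simps)
  qed (use that tanh_ge_cubic in auto)
  from this[of "\<bar>t\<bar>"] show ?thesis by simp
qed

lemma ln_cosh_le: "ln (cosh (t :: real)) \<le> t\<^sup>2 / 2 - t ^ 4 / 12 + t ^ 6 / 45"
proof -
  have "0 \<le> (s\<^sup>2 / 2 - s ^ 4 / 12 + s ^ 6 / 45) - ln (cosh s)" if "0 \<le> s" for s :: real
  proof (rule nonneg_of_deriv_nonneg[where f = "\<lambda>s. (s\<^sup>2 / 2 - s ^ 4 / 12 + s ^ 6 / 45) - ln (cosh s)"
        and f' = "\<lambda>s. (s - s ^ 3 / 3 + 2 * s ^ 5 / 15) - tanh s"])
    fix s :: real
    show "((\<lambda>s. (s\<^sup>2 / 2 - s ^ 4 / 12 + s ^ 6 / 45) - ln (cosh s)) has_real_derivative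
        (s - s ^ 3 / 3 + 2 * s ^ 5 / 15) - tanh s) (at s)"
      by (auto intro!: derivative_eq_intros simp: tanh_def field_simps)
    show "0 \<le> (s - s ^ 3 / 3 + 2 * s ^ 5 / 15) - tanh s" if "0 \<le> s"
      using tanh_le_quintic[OF that] by simp
  qed (use that in auto)
  from this[of "\<bar>t\<bar>"] show ?thesis by simp
qed

text \<open>
  Quantifies how much smaller than the Gaussian bound \<open>exp (t\<^sup>2 / 2)\<close> the function \<open>cosh\<close> is. In the
  variable \<open>t\<^sup>2\<close> the gain is the convex function \<open>y \<mapsto> y\<^sup>2 / (1 + y)\<close>, so that it can be summed by
  Jensen's inequality when only \<open>\<Sum> t\<^sub>i\<^sup>2\<close> is known.
\<close>

lemma ln_cosh_le_subgaussian: "ln (cosh (t :: real)) - t\<^sup>2 / 2 \<le> - ((t\<^sup>2)\<^sup>2 / (1 + t\<^sup>2)) / 24"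
proof -
  have pos: "1 + s\<^sup>2 > 0" for s :: real by (simp add: add_pos_nonneg)
  have eq: "(s\<^sup>2)\<^sup>2 / (1 + s\<^sup>2) = s\<^sup>2 - 1 + 1 / (1 + s\<^sup>2)" for s :: real
    using pos[of s] by (simp add: divide_simps) (simp add: algebra_simps power2_eq_square power4_eq_xxxx)
  have "0 \<le> (s\<^sup>2 / 2 - (s\<^sup>2 - 1 + 1 / (1 + s\<^sup>2)) / 24) - ln (cosh s)" if "0 \<le> s" for s :: real
  proof (rule nonneg_of_deriv_nonneg[where f = "\<lambda>s. (s\<^sup>2 / 2 - (s\<^sup>2 - 1 + 1 / (1 + s\<^sup>2)) / 24) - ln (cosh s)"
        and f' = "\<lambda>s. s - (2 * s - 2 * s / (1 + s\<^sup>2)\<^sup>2) / 24 - tanh s"])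
    fix s :: real
    show "((\<lambda>s. (s\<^sup>2 / 2 - (s\<^sup>2 - 1 + 1 / (1 + s\<^sup>2)) / 24) - ln (cosh s)) has_real_derivative
        s - (2 * s - 2 * s / (1 + s\<^sup>2)\<^sup>2) / 24 - tanh s) (at s)"
      using pos[of s]
      by (auto intro!: derivative_eq_intros simp: tanh_def power2_eq_square)
    assume s: "0 \<le> s"
    have "(2 * s - 2 * s / (1 + s\<^sup>2)\<^sup>2) / 24 \<le> (s - s / (1 + s\<^sup>2)) / 6"
    proof -
      define r where "r = s / (1 + s\<^sup>2)"
      define q where "q = s / (1 + s\<^sup>2)\<^sup>2"
      have "0 \<le> s * (1 - 1 / (1 + s\<^sup>2))\<^sup>2" using s by simp
      then have "0 \<le> s - 2 * r + q"
        by (simp add: r_def q_def power2_diff power_divide algebra_simps)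
      then have "(2 * s - 2 * q) / 24 \<le> (s - r) / 6" by (simp add: field_simps)
      then show ?thesis by (simp add: r_def q_def)
    qed
    then show "0 \<le> s - (2 * s - 2 * s / (1 + s\<^sup>2)\<^sup>2) / 24 - tanh s"
      using tanh_le_rational[OF s] by linarith
  qed (use that in auto)
  from this[of "\<bar>t\<bar>"]
  have "0 \<le> t\<^sup>2 / 2 - (t\<^sup>2)\<^sup>2 / (1 + t\<^sup>2) / 24 - ln (cosh t)" unfolding eq by simp
  moreover have "a - b \<le> - c / 24" if "0 \<le> b - c / 24 - a" for a b c :: real
    using that by simp
  ultimately show ?thesis by blast
qed

text \<open>
  Jensen's inequality for the convex function \<open>y \<mapsto> y\<^sup>2 / (1 + y)\<close>, from a tangent bound
  \<open>y\<^sup>2 / (1 + y) \<ge> 2 s y - s\<^sup>2 (1 + y)\<close> with the slope parameter \<open>s\<close> that is optimal for the mean.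
\<close>

lemma sum_square_div_ge:
  fixes y :: "'i \<Rightarrow> real"
  assumes "\<And>i. i \<in> I \<Longrightarrow> 0 \<le> y i" and "finite I"
  shows "(sum y I)\<^sup>2 / (card I + sum y I) \<le> (\<Sum>i\<in>I. (y i)\<^sup>2 / (1 + y i))"
proof -
  define Y where "Y = sum y I"
  define D where "D = card I + Y"
  define s where "s = Y / D"
  have "0 \<le> Y" unfolding Y_def using assms by (simp add: sum_nonneg)
  have "Y\<^sup>2 / D = 2 * s * Y - s\<^sup>2 * D"
    unfolding s_def by (simp add: power2_eq_square)
  also have "\<dots> = (\<Sum>i\<in>I. 2 * s * y i - s\<^sup>2 * (1 + y i))"
    by (simp add: Y_def D_def sum_subtractf sum_distrib_left distrib_left sum.distrib)
  also have "\<dots> \<le> (\<Sum>i\<in>I. (y i)\<^sup>2 / (1 + y i))"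
  proof (rule sum_mono)
    fix i assume "i \<in> I"
    then have y: "0 \<le> y i" using assms by simp
    have "0 \<le> (y i - s * (1 + y i))\<^sup>2" by simp
    then have "(2 * s * y i - s\<^sup>2 * (1 + y i)) * (1 + y i) \<le> (y i)\<^sup>2"
      by (simp add: power2_eq_square algebra_simps)
    then show "2 * s * y i - s\<^sup>2 * (1 + y i) \<le> (y i)\<^sup>2 / (1 + y i)"
      using y by (simp add: pos_le_divide_eq)
  qed
  finally show ?thesis by (simp add: Y_def D_def)
qed

lemma abs_exp_diff_le:
  fixes a b :: real
  assumes "0 \<le> a" "0 \<le> b"
  shows "\<bar>exp (- a) - exp (- b)\<bar> \<le> \<bar>a - b\<bar>"
proof -
  have "exp (- s) - exp (- t) \<le> t - s" if "0 \<le> s" "s \<le> t" for s t :: real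
  proof -
    have "exp (- s) - exp (- t) = exp (- s) * (1 - exp (- (t - s)))"
      by (simp add: algebra_simps flip: exp_add)
    also have "\<dots> \<le> 1 * (t - s)"
    proof (intro mult_mono)
      show "1 - exp (- (t - s)) \<le> t - s" using exp_ge_add_one_self[of "- (t - s)"] by linarith
    qed (use that in auto)
    finally show ?thesis by simp
  qed
  from this[of a b] this[of b a] assms show ?thesis by (cases "a \<le> b") auto
qed

section \<open>The quartic law\<close>

lemma integrable_exp_quartic: "integrable lborel (\<lambda>s::real. exp (- (s ^ 4) / 12))"
proof (rule Bochner_Integration.integrable_bound)
  show "integrable lborel (\<lambda>s. exp 3 * (sqrt (2 * pi * (1 / sqrt 2)\<^sup>2) * normal_density 0 (1 / sqrt 2) s))"
    by (intro integrable_mult_right) auto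
  show "AE s in lborel. norm (exp (- (s ^ 4) / 12)) \<le>
      norm (exp 3 * (sqrt (2 * pi * (1 / sqrt 2)\<^sup>2) * normal_density 0 (1 / sqrt 2) s))"
  proof (rule AE_I2)
    fix s :: real
    have "0 \<le> (s\<^sup>2 - 6)\<^sup>2" by simp
    then have "- (s ^ 4) / 12 \<le> 3 + - s\<^sup>2"
      by (simp add: power2_eq_square power4_eq_xxxx field_simps)
    then have "exp (- (s ^ 4) / 12) \<le> exp 3 * exp (- s\<^sup>2)" by (simp flip: exp_add)
    also have "exp (- s\<^sup>2) = sqrt (2 * pi * (1 / sqrt 2)\<^sup>2) * normal_density 0 (1 / sqrt 2) s"
      by (simp add: normal_density_def power_divide)
    finally show "norm (exp (- (s ^ 4) / 12)) \<le>
      norm (exp 3 * (sqrt (2 * pi * (1 / sqrt 2)\<^sup>2) * normal_density 0 (1 / sqrt 2) s))"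
      by simp
  qed
qed simp

lemma has_integral_closed_open_ray:
  fixes f :: "real \<Rightarrow> real"
  shows "(f has_integral y) {0..} \<longleftrightarrow> (f has_integral y) {0<..}"
  by (rule has_integral_spike_set_eq) (rule negligible_subset[OF negligible_sing[of 0]], force)+

text \<open>
  On the positive half-line the substitution \<open>t = s\<^sup>4 / 12\<close> leads to Euler's integral for \<open>Gamma (1 / 4)\<close>.
\<close>

lemma integral_exp_quartic:
  "(\<integral>s. exp (- (s ^ 4) / 12) \<partial>lborel) = (3 / 4) powr (1 / 4) * Gamma (1 / 4 :: real)"
proof -
  let ?e = "\<lambda>s::real. exp (- (s ^ 4) / 12)"
  define f where "f t = t powr (1 / 4 - 1) / exp t" for t :: real
  define g where "g s = s ^ 4 / 12" for s :: real
  define c :: real where "c = 12 powr (3 / 4) / 3"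
  have im: "g ` {0<..} = {0<..}"
  proof (intro equalityI subsetI)
    fix t :: real assume t: "t \<in> {0<..}"
    have "g ((12 * t) powr (1 / 4)) = t"
      using t by (simp add: g_def powr_power)
    then show "t \<in> g ` {0<..}" using t by (intro image_eqI[of _ _ "(12 * t) powr (1 / 4)"]) auto
  qed (auto simp: g_def)
  have "(f has_integral Gamma (1 / 4)) {0..}"
    using Gamma_integral_real[of "1 / 4 :: real"] by (simp add: f_def[abs_def])
  then have fi: "(f has_integral Gamma (1 / 4)) {0<..}"
    by (simp add: has_integral_closed_open_ray)
  have abs_f: "f absolutely_integrable_on {0<..}"
    using fi by (intro nonnegative_absolutely_integrable_1) (auto simp: f_def)
  have "(\<lambda>x. \<bar>x ^ 3 / 3\<bar> * f (g x)) absolutely_integrable_on {0<..} \<and>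
        integral {0<..} (\<lambda>x. \<bar>x ^ 3 / 3\<bar> * f (g x)) = Gamma (1 / 4)
     \<longleftrightarrow> f absolutely_integrable_on (g ` {0<..}) \<and> integral (g ` {0<..}) f = Gamma (1 / 4)"
  proof (rule has_absolute_integral_change_of_variables_1')
    show "{0<..} \<in> sets (lebesgue :: real measure)" by simp
    show "(g has_real_derivative x ^ 3 / 3) (at x within {0<..})" for x
      unfolding g_def by (auto intro!: derivative_eq_intros)
    show "inj_on g {0<..}"
      by (rule inj_onI) (auto simp: g_def power_eq_iff_eq_base)
  qed
  then have A: "(\<lambda>x. \<bar>x ^ 3 / 3\<bar> * f (g x)) absolutely_integrable_on {0<..}"
    and B: "integral {0<..} (\<lambda>x. \<bar>x ^ 3 / 3\<bar> * f (g x)) = Gamma (1 / 4)"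
    using abs_f fi unfolding im by auto
  have eq: "\<bar>x ^ 3 / 3\<bar> * f (g x) = c * ?e x" if "x \<in> {0<..}" for x
  proof -
    have x: "x > 0" using that by simp
    have "(x ^ 4 / 12) powr (- (3 / 4)) = (x ^ 4) powr (- (3 / 4)) / 12 powr (- (3 / 4))"
      using x by (intro powr_divide)
    also have "(x ^ 4) powr (- (3 / 4)) = x powr (- 3)"
    proof -
      have "x ^ 4 = x powr 4" using x powr_realpow[of x 4] by simp
      then show ?thesis by (simp add: powr_powr)
    qed
    also have "\<dots> = 1 / x ^ 3" using x by (simp add: powr_minus powr_realpow divide_simps)
    finally have "(x ^ 4 / 12) powr (- (3 / 4)) = 12 powr (3 / 4) / x ^ 3"
      by (simp add: powr_minus divide_simps)
    then show ?thesis using x by (simp add: f_def g_def c_def exp_minus divide_simps mult.commute)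
  qed
  have c0: "c > 0" by (simp add: c_def)
  have "(\<lambda>x. c * ?e x) absolutely_integrable_on {0<..}"
    using A by (subst (asm) set_integrable_cong[OF refl refl eq]) auto
  moreover have "integral {0<..} (\<lambda>x. c * ?e x) = Gamma (1 / 4)"
    using B by (subst (asm) Henstock_Kurzweil_Integration.integral_cong[OF eq]) auto
  ultimately have C: "((\<lambda>x. c * ?e x) has_integral Gamma (1 / 4)) {0<..}"
    by (metis absolutely_integrable_on_def has_integral_iff)
  have pos: "(?e has_integral Gamma (1 / 4) / c) {0<..}"
    using has_integral_mult_right[OF C, of "1 / c"] c0 by (simp add: field_simps)
  have pos': "(?e has_integral Gamma (1 / 4) / c) {0..}"
    using pos by (simp add: has_integral_closed_open_ray)
  have "set_integrable lborel {0..} ?e"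
    unfolding set_integrable_def by (rule integrable_mult_indicator[OF _ integrable_exp_quartic]) simp
  then have hb: "has_bochner_integral lborel (\<lambda>x. indicator {0..} x *\<^sub>R ?e x) (Gamma (1 / 4) / c)"
    using has_integral_set_lebesgue set_borel_integral_eq_integral(2)[of "{0..}" ?e] pos'
    by (auto simp: has_bochner_integral_iff set_integrable_def set_lebesgue_integral_def integral_unique)
  have "has_bochner_integral lborel ?e (2 *\<^sub>R (Gamma (1 / 4) / c))"
    by (rule has_bochner_integral_even_function[OF hb]) simp
  then have "(\<integral>s. ?e s \<partial>lborel) = 2 * (Gamma (1 / 4) / c)"
    by (simp add: has_bochner_integral_integral_eq)
  also have "\<dots> = (2 / c) * Gamma (1 / 4)" by simp
  also have "2 / c = (3 / 4) powr (1 / 4)"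
  proof (rule power_eq_imp_eq_base[of _ 4])
    have "(12 powr (3 / 4)) ^ 4 = (12 :: real) ^ 3"
      using powr_realpow[of 12 3] by (simp add: powr_power)
    then show "(2 / c) ^ 4 = ((3 / 4) powr (1 / 4)) ^ 4"
      unfolding c_def by (simp add: power_divide power_mult_distrib powr_power)
  qed (use c0 in auto)
  finally show ?thesis .
qed

definition quartic_mass :: real where
  "quartic_mass = (\<integral>u. exp (- (u ^ 4) / 12 :: real) \<partial>lborel)"

lemma quartic_mass_eq: "quartic_mass = (3 / 4) powr (1 / 4) * Gamma (1 / 4)"
  unfolding quartic_mass_def by (rule integral_exp_quartic)

lemma quartic_mass_pos: "0 < quartic_mass"
  unfolding quartic_mass_eq by (simp add: Gamma_real_pos)

definition quartic_law :: "real measure" where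
  "quartic_law = density lborel
     (\<lambda>s. ennreal ((4 / 3) powr (1 / 4) * inverse (Gamma (1 / 4)) * exp (- (s ^ 4) / 12)))"

lemma quartic_normalisation:
  "(4 / 3) powr (1 / 4) * inverse (Gamma (1 / 4)) = 1 / quartic_mass"
proof -
  have "(4 / 3 :: real) powr (1 / 4) * (3 / 4) powr (1 / 4) = 1"
    by (simp flip: powr_mult)
  then have "(4 / 3 :: real) powr (1 / 4) = 1 / (3 / 4) powr (1 / 4)"
    by (simp add: eq_divide_eq)
  then show ?thesis
    unfolding quartic_mass_eq by (simp only: inverse_eq_divide times_divide_times_eq mult_1_left)
qed

lemma integral_quartic_law:
  fixes \<phi> :: "real \<Rightarrow> real"
  assumes [measurable]: "\<phi> \<in> borel_measurable borel"
  shows "(\<integral>s. \<phi> s \<partial>quartic_law)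
    = (\<integral>u. \<phi> u * exp (- (u ^ 4) / 12) \<partial>lborel) / quartic_mass"
proof -
  have I: "0 < quartic_mass" by (rule quartic_mass_pos)
  have "(\<integral>s. \<phi> s \<partial>quartic_law) = (\<integral>s. (1 / quartic_mass * exp (- (s ^ 4) / 12)) *\<^sub>R \<phi> s \<partial>lborel)"
    unfolding quartic_law_def quartic_normalisation
    by (rule integral_density) (use I in \<open>auto simp: less_imp_le\<close>)
  also have "\<dots> = (\<integral>s. \<phi> s * exp (- (s ^ 4) / 12) / quartic_mass \<partial>lborel)"
    by (simp add: mult_ac)
  finally show ?thesis by simp
qed

lemma real_distribution_quartic_law: "real_distribution quartic_law"
proof -
  have I: "0 < quartic_mass" by (rule quartic_mass_pos)
  have "emeasure quartic_law (space quartic_law) = (\<integral>\<^sup>+s. ennreal (1 / quartic_mass * exp (- (s ^ 4) / 12)) \<partial>lborel)"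
    unfolding quartic_law_def quartic_normalisation by (subst emeasure_density) auto
  also have "\<dots> = ennreal (\<integral>s. 1 / quartic_mass * exp (- (s ^ 4) / 12) \<partial>lborel)"
    using I by (intro nn_integral_eq_integral integrable_mult_right integrable_exp_quartic) (auto simp: less_imp_le)
  also have "(\<integral>s. 1 / quartic_mass * exp (- (s ^ 4) / 12) \<partial>lborel) = 1 / quartic_mass * quartic_mass"
    by (subst integral_mult_right_zero) (simp only: quartic_mass_def)
  also have "1 / quartic_mass * quartic_mass = 1" using I by simp
  finally have "prob_space quartic_law" by (intro prob_spaceI) simp
  then show ?thesis
    by (simp add: real_distribution_def real_distribution_axioms_def quartic_law_def)
qed

section \<open>Sums over i.i.d. samples\<close>

lemma (in prob_space) L1_le_L2:
  fixes W :: "'a \<Rightarrow> real"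
  assumes "W \<in> borel_measurable M" and "integrable M (\<lambda>x. (W x)\<^sup>2)"
  shows "expectation (\<lambda>x. \<bar>W x\<bar>) \<le> sqrt (expectation (\<lambda>x. (W x)\<^sup>2))"
proof -
  have "integrable M (\<lambda>x. \<bar>W x\<bar>)"
    by (rule integrable_abs[OF square_integrable_imp_integrable[OF assms]])
  then have "variance (\<lambda>x. \<bar>W x\<bar>) = expectation (\<lambda>x. \<bar>W x\<bar>\<^sup>2) - (expectation (\<lambda>x. \<bar>W x\<bar>))\<^sup>2"
    using assms by (intro variance_eq) auto
  moreover have "0 \<le> variance (\<lambda>x. \<bar>W x\<bar>)" by (rule variance_positive)
  ultimately have "(expectation (\<lambda>x. \<bar>W x\<bar>))\<^sup>2 \<le> expectation (\<lambda>x. (W x)\<^sup>2)" by simp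
  then show ?thesis by (rule real_le_rsqrt)
qed

context prob_space
begin

lemma product_prob_space_iid: "product_prob_space (\<lambda>_::nat. M)"
  by (rule product_prob_spaceI) (rule prob_space_axioms)

lemma product_sigma_finite_iid: "product_sigma_finite (\<lambda>_::nat. M)"
  using product_prob_space_iid by (simp add: product_prob_space_def)

lemma prob_space_iid: "prob_space (\<Pi>\<^sub>M i\<in>{..<n::nat}. M)"
  by (rule prob_space_PiM) (rule prob_space_axioms)

lemma
  fixes q :: "'a \<Rightarrow> real"
  assumes "i < n" and "integrable M q"
  shows integrable_iid_component: "integrable (\<Pi>\<^sub>M i\<in>{..<n::nat}. M) (\<lambda>x. q (x i))"
    and integral_iid_component: "(\<integral>x. q (x i) \<partial>(\<Pi>\<^sub>M i\<in>{..<n}. M)) = expectation q"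
proof -
  have eq: "distr (\<Pi>\<^sub>M i\<in>{..<n::nat}. M) M (\<lambda>x. x i) = M"
    using assms by (intro distr_PiM_component) (auto intro: prob_space_axioms)
  have [measurable]: "(\<lambda>x. x i) \<in> measurable (\<Pi>\<^sub>M i\<in>{..<n::nat}. M) M"
    using assms by (intro measurable_component_singleton) auto
  have [measurable]: "q \<in> borel_measurable M" using assms by auto
  have "integrable (distr (\<Pi>\<^sub>M i\<in>{..<n::nat}. M) M (\<lambda>x. x i)) q" unfolding eq by fact
  then show "integrable (\<Pi>\<^sub>M i\<in>{..<n::nat}. M) (\<lambda>x. q (x i))"
    by (simp add: integrable_distr_eq)
  have "expectation q = integral\<^sup>L (distr (\<Pi>\<^sub>M i\<in>{..<n::nat}. M) M (\<lambda>x. x i)) q" unfolding eq ..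
  also have "\<dots> = (\<integral>x. q (x i) \<partial>(\<Pi>\<^sub>M i\<in>{..<n}. M))"
    by (simp add: integral_distr)
  finally show "(\<integral>x. q (x i) \<partial>(\<Pi>\<^sub>M i\<in>{..<n}. M)) = expectation q" by simp
qed

lemma
  fixes z :: "'a \<Rightarrow> real"
  assumes "i < n" "j < n" "i \<noteq> j" and z: "integrable M z" "expectation z = 0"
  shows integrable_iid_mult: "integrable (\<Pi>\<^sub>M i\<in>{..<n::nat}. M) (\<lambda>x. z (x i) * z (x j))"
    and integral_iid_mult: "(\<integral>x. z (x i) * z (x j) \<partial>(\<Pi>\<^sub>M i\<in>{..<n}. M)) = 0"
proof -
  interpret product_sigma_finite "\<lambda>_::nat. M" by (rule product_sigma_finite_iid)
  define h where "h l = (if l = i \<or> l = j then z else (\<lambda>_. 1))" for l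
  have int: "integrable M (h l)" for l using z by (simp add: h_def)
  have eq: "(\<Prod>l<n. h l (x l)) = z (x i) * z (x j)" for x
  proof -
    have "(\<Prod>l<n. h l (x l)) = (\<Prod>l\<in>{i, j}. h l (x l))"
      using assms by (intro prod.mono_neutral_right) (auto simp: h_def)
    also have "\<dots> = z (x i) * z (x j)" using assms by (simp add: h_def)
    finally show ?thesis .
  qed
  show "integrable (\<Pi>\<^sub>M i\<in>{..<n::nat}. M) (\<lambda>x. z (x i) * z (x j))"
    using product_integrable_prod[of "{..<n}" h] int by (simp add: eq)
  have "(\<integral>x. z (x i) * z (x j) \<partial>(\<Pi>\<^sub>M i\<in>{..<n}. M)) = (\<Prod>l<n. expectation (h l))"
    using product_integral_prod[of "{..<n}" h] int by (simp add: eq)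
  also have "\<dots> = 0"
  proof (rule prod_zero)
    have "expectation (h i) = 0" by (simp add: h_def z(2))
    then show "\<exists>l\<in>{..<n}. expectation (h l) = 0" using \<open>i < n\<close> by blast
  qed simp
  finally show "(\<integral>x. z (x i) * z (x j) \<partial>(\<Pi>\<^sub>M i\<in>{..<n}. M)) = 0" .
qed

lemma integrable_iid_sum_square:
  fixes z :: "'a \<Rightarrow> real"
  assumes z: "z \<in> borel_measurable M" "integrable M (\<lambda>x. (z x)\<^sup>2)" "expectation z = 0"
  shows "integrable (\<Pi>\<^sub>M i\<in>{..<n::nat}. M) (\<lambda>x. (\<Sum>i<n. z (x i))\<^sup>2)"
    and "(\<integral>x. (\<Sum>i<n. z (x i))\<^sup>2 \<partial>(\<Pi>\<^sub>M i\<in>{..<n::nat}. M)) = n * expectation (\<lambda>x. (z x)\<^sup>2)"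
proof -
  have z1: "integrable M z" by (rule square_integrable_imp_integrable[OF z(1,2)])
  have int: "integrable (\<Pi>\<^sub>M i\<in>{..<n::nat}. M) (\<lambda>x. z (x i) * z (x j))" if "i < n" "j < n" for i j
  proof (cases "i = j")
    case True
    show ?thesis using integrable_iid_component[OF that(1) z(2)] by (simp add: True power2_eq_square)
  qed (rule integrable_iid_mult[OF that _ z1 z(3)])
  have val: "(\<integral>x. z (x i) * z (x j) \<partial>(\<Pi>\<^sub>M i\<in>{..<n}. M))
      = (if j = i then expectation (\<lambda>x. (z x)\<^sup>2) else 0)" if "i < n" "j < n" for i j
  proof (cases "i = j")
    case True
    show ?thesis using integral_iid_component[OF that(1) z(2)] by (simp add: True power2_eq_square)
  next
    case False
    show ?thesis using integral_iid_mult[OF that False z1 z(3)] False by simp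
  qed
  have eq: "(\<Sum>i<n. z (x i))\<^sup>2 = (\<Sum>i<n. \<Sum>j<n. z (x i) * z (x j))" for x :: "nat \<Rightarrow> 'a"
    by (simp add: power2_eq_square sum_product)
  show "integrable (\<Pi>\<^sub>M i\<in>{..<n::nat}. M) (\<lambda>x. (\<Sum>i<n. z (x i))\<^sup>2)"
    unfolding eq by (intro Bochner_Integration.integrable_sum int) auto
  have "(\<integral>x. (\<Sum>i<n. z (x i))\<^sup>2 \<partial>(\<Pi>\<^sub>M i\<in>{..<n::nat}. M))
      = (\<Sum>i<n. \<integral>x. (\<Sum>j<n. z (x i) * z (x j)) \<partial>(\<Pi>\<^sub>M i\<in>{..<n}. M))"
    unfolding eq by (intro Bochner_Integration.integral_sum Bochner_Integration.integrable_sum int) auto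
  also have "\<dots> = (\<Sum>i<n. \<Sum>j<n. \<integral>x. z (x i) * z (x j) \<partial>(\<Pi>\<^sub>M i\<in>{..<n}. M))"
    by (intro sum.cong refl Bochner_Integration.integral_sum int) auto
  also have "\<dots> = (\<Sum>i<n. \<Sum>j<n. if j = i then expectation (\<lambda>x. (z x)\<^sup>2) else 0)"
    by (intro sum.cong refl val) auto
  also have "\<dots> = n * expectation (\<lambda>x. (z x)\<^sup>2)" by simp
  finally show "(\<integral>x. (\<Sum>i<n. z (x i))\<^sup>2 \<partial>(\<Pi>\<^sub>M i\<in>{..<n::nat}. M)) = n * expectation (\<lambda>x. (z x)\<^sup>2)" .
qed

text \<open>
  A quantitative law of large numbers: Chebyshev's second moment computation, combined with
  \<open>E|W| \<le> \<surd>(E W\<^sup>2)\<close>. It is used in this form because the deviations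
  of the empirical moments enter the error bounds below linearly.
\<close>

lemma weak_law_L1:
  fixes q :: "'a \<Rightarrow> real"
  assumes q: "q \<in> borel_measurable M" "integrable M (\<lambda>x. (q x)\<^sup>2)" and "n \<ge> 1"
  shows "integrable (\<Pi>\<^sub>M i\<in>{..<n::nat}. M) (\<lambda>x. \<bar>(\<Sum>i<n. q (x i)) / n - expectation q\<bar>)" (is ?A)
    and "(\<integral>x. \<bar>(\<Sum>i<n. q (x i)) / n - expectation q\<bar> \<partial>(\<Pi>\<^sub>M i\<in>{..<n::nat}. M))
      \<le> sqrt (variance q / n)" (is ?B)
proof -
  interpret P: prob_space "\<Pi>\<^sub>M i\<in>{..<n::nat}. M" by (rule prob_space_iid)
  define z where "z x = q x - expectation q" for x
  have q1: "integrable M q" by (rule square_integrable_imp_integrable[OF q])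
  have z: "z \<in> borel_measurable M" "integrable M (\<lambda>x. (z x)\<^sup>2)" "expectation z = 0"
    using q q1 by (auto simp: z_def[abs_def] power2_diff prob_space)
  have eq: "(\<Sum>i<n. q (x i)) / n - expectation q = (\<Sum>i<n. z (x i)) / n" for x :: "nat \<Rightarrow> 'a"
    using \<open>n \<ge> 1\<close> by (simp add: z_def sum_subtractf field_simps)
  have int: "integrable (\<Pi>\<^sub>M i\<in>{..<n::nat}. M) (\<lambda>x. ((\<Sum>i<n. z (x i)) / n)\<^sup>2)"
    using integrable_iid_sum_square(1)[OF z] by (simp add: power_divide)
  have meas: "(\<lambda>x. (\<Sum>i<n. z (x i)) / n) \<in> borel_measurable (\<Pi>\<^sub>M i\<in>{..<n::nat}. M)"
  proof (intro borel_measurable_divide borel_measurable_sum)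
    fix i assume "i \<in> {..<n}"
    then show "(\<lambda>x. z (x i)) \<in> borel_measurable (\<Pi>\<^sub>M i\<in>{..<n::nat}. M)"
      by (rule measurable_compose[OF measurable_component_singleton[of i "{..<n}" "\<lambda>_. M"] z(1)])
  qed simp
  show ?A unfolding eq
    by (rule integrable_abs[OF P.square_integrable_imp_integrable[OF meas int]])
  have "(\<integral>x. \<bar>(\<Sum>i<n. z (x i)) / n\<bar> \<partial>(\<Pi>\<^sub>M i\<in>{..<n::nat}. M))
      \<le> sqrt (\<integral>x. ((\<Sum>i<n. z (x i)) / n)\<^sup>2 \<partial>(\<Pi>\<^sub>M i\<in>{..<n::nat}. M))"
    by (rule P.L1_le_L2[OF meas int])
  also have "(\<integral>x. ((\<Sum>i<n. z (x i)) / n)\<^sup>2 \<partial>(\<Pi>\<^sub>M i\<in>{..<n::nat}. M)) = variance q / n"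
    using integrable_iid_sum_square(2)[OF z, of n] \<open>n \<ge> 1\<close>
    by (simp add: power_divide z_def power2_eq_square)
  finally show ?B unfolding eq .
qed

end

section \<open>Symmetric laws and symmetrisation\<close>

text \<open>
  The setting of the limit theorem: the eighth moment makes the empirical fourth moment
  concentrate in mean square.
\<close>

locale symmetric_law = prob_space \<rho> for \<rho> :: "real measure" +
  assumes sets_law [measurable_cong]: "sets \<rho> = sets borel"
    and symmetric: "distr \<rho> borel uminus = \<rho>"
    and eighth_moment: "integrable \<rho> (\<lambda>x. x ^ 8)"
    and second_moment_pos: "0 < expectation (\<lambda>x. x\<^sup>2)"
begin

abbreviation sample :: "nat \<Rightarrow> (nat \<Rightarrow> real) measure" where
  "sample n \<equiv> \<Pi>\<^sub>M i\<in>{..<n}. \<rho>"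

lemma space_law [simp]: "space \<rho> = UNIV"
  using sets_eq_imp_space_eq[OF sets_law] by simp

lemma coordinate_measurable:
  "i < n \<Longrightarrow> (\<lambda>x. x i) \<in> borel_measurable (sample n)"
  using measurable_component_singleton[of i "{..<n}" "\<lambda>_. \<rho>"]
  unfolding measurable_cong_sets[OF refl sets_law] by simp

definition flip :: "nat \<Rightarrow> (nat \<Rightarrow> real) \<Rightarrow> nat \<Rightarrow> real" where
  "flip j x = x(j := - x j)"

lemma flip_measurable [measurable]:
  assumes "j < n" shows "flip j \<in> measurable (sample n) (sample n)"
proof -
  have "(\<lambda>x i. if i = j then - x j else x i) \<in> measurable (sample n) (sample n)"
  proof (rule measurable_PiM_single')
    fix i assume "i \<in> {..<n}"
    then have "(\<lambda>x. if i = j then - x j else x i) \<in> borel_measurable (sample n)"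
      using assms coordinate_measurable by (cases "i = j") simp_all
    then show "(\<lambda>x. if i = j then - x j else x i) \<in> measurable (sample n) \<rho>"
      unfolding measurable_cong_sets[OF refl sets_law] .
  qed (use assms in \<open>auto simp: space_PiM PiE_iff extensional_def\<close>)
  also have "(\<lambda>x i. if i = j then - x j else x i) = flip j"
    by (auto simp: fun_eq_iff flip_def)
  finally show ?thesis .
qed

lemma distr_flip:
  assumes j: "j < n" shows "distr (sample n) (sample n) (flip j) = sample n"
proof -
  interpret product_sigma_finite "\<lambda>_::nat. \<rho>" by (rule product_sigma_finite_iid)
  show ?thesis
  proof (rule PiM_eqI)
    fix A :: "nat \<Rightarrow> real set" assume A: "\<And>i. i \<in> {..<n} \<Longrightarrow> A i \<in> sets \<rho>"
    define B where "B = A(j := uminus -` A j)"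
    have Bj: "uminus -` A j \<in> sets \<rho>"
      using A[of j] j measurable_sets[of uminus borel borel "A j"] by (simp add: sets_law)
    have B: "B i \<in> sets \<rho>" if "i < n" for i
      using A that Bj by (auto simp: B_def)
    have emB: "emeasure \<rho> (B i) = emeasure \<rho> (A i)" if "i < n" for i
    proof (cases "i = j")
      case True
      have "emeasure \<rho> (A j) = emeasure (distr \<rho> borel uminus) (A j)" by (simp add: symmetric)
      also have "\<dots> = emeasure \<rho> (uminus -` A j)"
        using A[of j] j by (subst emeasure_distr) (auto simp: sets_law measurable_cong_sets[OF sets_law refl])
      finally show ?thesis using True by (simp add: B_def)
    qed (simp add: B_def)
    have "flip j -` Pi\<^sub>E {..<n} A \<inter> space (sample n) = Pi\<^sub>E {..<n} B"
    proof (rule set_eqI)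
      fix x
      have "(\<forall>i<n. flip j x i \<in> A i) \<longleftrightarrow> (\<forall>i<n. x i \<in> B i)"
        unfolding flip_def B_def fun_upd_def by (intro all_cong) simp
      moreover have "flip j x \<in> extensional {..<n} \<longleftrightarrow> x \<in> extensional {..<n}"
        using j by (auto simp: flip_def extensional_def)
      ultimately show "x \<in> flip j -` Pi\<^sub>E {..<n} A \<inter> space (sample n) \<longleftrightarrow> x \<in> Pi\<^sub>E {..<n} B"
        by (simp add: space_PiM PiE_def Pi_def)
    qed
    then have "emeasure (distr (sample n) (sample n) (flip j)) (Pi\<^sub>E {..<n} A)
        = emeasure (sample n) (Pi\<^sub>E {..<n} B)"
      using A j by (subst emeasure_distr) (auto intro!: sets_PiM_I_finite)
    also have "\<dots> = (\<Prod>i<n. emeasure \<rho> (B i))"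
      using B by (intro emeasure_PiM) auto
    also have "\<dots> = (\<Prod>i<n. emeasure \<rho> (A i))"
      using emB by (intro prod.cong) auto
    finally show "emeasure (distr (sample n) (sample n) (flip j)) (Pi\<^sub>E {..<n} A)
        = (\<Prod>i<n. emeasure \<rho> (A i))" .
  qed simp_all
qed

text \<open>
  The law of a sample is invariant under a sign change in one coordinate, so an integrand may be
  averaged over that sign.
\<close>

lemma nn_integral_average_flip:
  assumes j: "j < n" and h[measurable]: "h \<in> borel_measurable (sample n)" and "\<And>x. 0 \<le> h x"
  shows "(\<integral>\<^sup>+x. ennreal (h x) \<partial>sample n) = (\<integral>\<^sup>+x. ennreal ((h x + h (flip j x)) / 2) \<partial>sample n)"
proof -
  have m[measurable]: "flip j \<in> measurable (sample n) (sample n)" using j by measurable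
  have "(\<integral>\<^sup>+x. ennreal (h x) \<partial>sample n) = (\<integral>\<^sup>+x. ennreal (h x) \<partial>distr (sample n) (sample n) (flip j))"
    using j by (simp add: distr_flip)
  also have "\<dots> = (\<integral>\<^sup>+x. ennreal (h (flip j x)) \<partial>sample n)"
    by (subst nn_integral_distr) auto
  finally have eq: "(\<integral>\<^sup>+x. ennreal (h (flip j x)) \<partial>sample n) = (\<integral>\<^sup>+x. ennreal (h x) \<partial>sample n)" ..
  have "(\<integral>\<^sup>+x. ennreal ((h x + h (flip j x)) / 2) \<partial>sample n)
      = (\<integral>\<^sup>+x. ennreal (1/2) * (ennreal (h x) + ennreal (h (flip j x))) \<partial>sample n)"
  proof (intro nn_integral_cong)
    fix x
    have "ennreal ((h x + h (flip j x)) / 2) = ennreal (1/2 * (h x + h (flip j x)))" by simp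
    also have "\<dots> = ennreal (1/2) * ennreal (h x + h (flip j x))"
      by (rule ennreal_mult) (simp_all add: assms(3))
    also have "ennreal (h x + h (flip j x)) = ennreal (h x) + ennreal (h (flip j x))"
      by (rule ennreal_plus) (simp_all add: assms(3))
    finally show "ennreal ((h x + h (flip j x)) / 2)
      = ennreal (1/2) * (ennreal (h x) + ennreal (h (flip j x)))" .
  qed
  also have "\<dots> = ennreal (1/2) * ((\<integral>\<^sup>+x. ennreal (h x) \<partial>sample n) + (\<integral>\<^sup>+x. ennreal (h x) \<partial>sample n))"
    by (simp add: nn_integral_cmult nn_integral_add eq)
  also have "\<dots> = (\<integral>\<^sup>+x. ennreal (h x) \<partial>sample n)"
  proof -
    have "ennreal (1/2) + ennreal (1/2) = ennreal (1/2 + 1/2)"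
      by (rule ennreal_plus[symmetric]) simp_all
    then have "ennreal (1/2) + ennreal (1/2) = 1" by simp
    then show ?thesis by (simp only: distrib_left flip: distrib_right) simp
  qed
  finally show ?thesis ..
qed

text \<open>
  If \<open>k\<close> and \<open>b\<close> depend only on the absolute values of the coordinates, then \<open>exp (b x\<^sub>j)\<close> can be
  averaged over the sign of \<open>x\<^sub>j\<close>, which gives \<open>cosh (b x\<^sub>j)\<close>. The induction performs this for one
  coordinate after the other; \<open>F J\<close> is the integrand after the coordinates in \<open>J\<close> have been treated.
\<close>

lemma symmetrisation:
  fixes k b :: "(nat \<Rightarrow> real) \<Rightarrow> real"
  assumes k[measurable]: "k \<in> borel_measurable (sample n)" and b[measurable]: "b \<in> borel_measurable (sample n)"
    and k0: "\<And>x. 0 \<le> k x"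
    and even: "\<And>j x. j < n \<Longrightarrow> k (flip j x) = k x" "\<And>j x. j < n \<Longrightarrow> b (flip j x) = b x"
  shows "(\<integral>\<^sup>+x. ennreal (k x * exp (b x * (\<Sum>i<n. x i))) \<partial>sample n)
    = (\<integral>\<^sup>+x. ennreal (k x * (\<Prod>i<n. cosh (b x * x i))) \<partial>sample n)"
proof -
  define F where "F J x = k x * ((\<Prod>i\<in>J. cosh (b x * x i)) * (\<Prod>i\<in>{..<n} - J. exp (b x * x i)))" for J x
  have F_meas: "F J \<in> borel_measurable (sample n)" if "J \<subseteq> {..<n}" for J
  proof -
    have "(\<lambda>x. cosh (b x * x i)) \<in> borel_measurable (sample n)" if "i < n" for i
      using that coordinate_measurable[OF that] unfolding cosh_def by measurable
    moreover have "(\<lambda>x. exp (b x * x i)) \<in> borel_measurable (sample n)" if "i < n" for i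
      using that coordinate_measurable[OF that] by measurable
    ultimately show ?thesis unfolding F_def using that k
      by (intro borel_measurable_times borel_measurable_prod) auto
  qed
  have "J \<subseteq> {..<n} \<Longrightarrow> (\<integral>\<^sup>+x. ennreal (F {} x) \<partial>sample n) = (\<integral>\<^sup>+x. ennreal (F J x) \<partial>sample n)"
    if "finite J" for J
    using that
  proof induction
    case (insert j J)
    then have j: "j < n" "j \<notin> J" and fin: "finite J" and J: "J \<subseteq> {..<n}" by auto
    have F0: "0 \<le> F J x" for x unfolding F_def by (intro mult_nonneg_nonneg prod_nonneg k0) (auto simp: less_imp_le)
    have split: "{..<n} - J = insert j ({..<n} - insert j J)" using j by auto
    define G where "G x = k x * ((\<Prod>i\<in>J. cosh (b x * x i)) * (\<Prod>i\<in>{..<n} - insert j J. exp (b x * x i)))" for x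
    have FJ: "F J x = G x * exp (b x * x j)" for x
      unfolding F_def G_def split by (subst prod.insert) auto
    have G_flip: "G (flip j x) = G x" for x
      unfolding G_def using j even by (auto simp: flip_def intro!: arg_cong2[of _ _ _ _ "(*)"] prod.cong)
    have "F J x + F J (flip j x) = 2 * F (insert j J) x" for x
      unfolding FJ G_flip using j fin even
      by (simp add: F_def G_def flip_def cosh_def exp_minus algebra_simps)
    then have "(\<integral>\<^sup>+x. ennreal (F J x) \<partial>sample n) = (\<integral>\<^sup>+x. ennreal (F (insert j J) x) \<partial>sample n)"
      using nn_integral_average_flip[OF j(1) F_meas[OF J] F0] by simp
    then show ?case using insert J by simp
  qed simp
  from this[of "{..<n}"] show ?thesis by (simp add: F_def exp_sum sum_distrib_left)
qed

definition variance_law :: real ("v") where "v = expectation (\<lambda>x. x\<^sup>2)"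
definition fourth_moment :: real ("m") where "m = expectation (\<lambda>x. x ^ 4)"

lemma moments:
  shows integrable_pow2: "integrable \<rho> (\<lambda>x. x\<^sup>2)"
    and integrable_pow4: "integrable \<rho> (\<lambda>x. x ^ 4)"
    and integrable_pow6: "integrable \<rho> (\<lambda>x. x ^ 6)"
proof -
  have "integrable \<rho> (\<lambda>x. x ^ k)" if "k \<le> 8" for k
  proof (rule Bochner_Integration.integrable_bound)
    show "integrable \<rho> (\<lambda>x. 1 + x ^ 8)" using eighth_moment by simp
    show "AE x in \<rho>. norm (x ^ k) \<le> norm (1 + x ^ 8)"
    proof (rule AE_I2)
      fix x :: real
      have "\<bar>x\<bar> ^ k \<le> 1 + \<bar>x\<bar> ^ 8"
      proof (cases "\<bar>x\<bar> \<le> 1")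
        case True
        then have "\<bar>x\<bar> ^ k \<le> 1" by (simp add: power_le_one)
        then show ?thesis by (simp add: add_increasing2)
      next
        case False
        then have "\<bar>x\<bar> ^ k \<le> \<bar>x\<bar> ^ 8" using that by (intro power_increasing) auto
        then show ?thesis by simp
      qed
      then show "norm (x ^ k) \<le> norm (1 + x ^ 8)" by (simp add: power_abs)
    qed
  qed (simp add: measurable_cong_sets[OF sets_law refl])
  from this[of 2] this[of 4] this[of 6]
  show "integrable \<rho> (\<lambda>x. x\<^sup>2)" "integrable \<rho> (\<lambda>x. x ^ 4)" "integrable \<rho> (\<lambda>x. x ^ 6)"
    by simp_all
qed

lemma v_pos: "0 < v"
  using second_moment_pos by (simp add: variance_law_def)

lemma v_sq_le_m: "v\<^sup>2 \<le> m"
proof -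
  have "variance (\<lambda>x. x\<^sup>2) = expectation (\<lambda>x. (x\<^sup>2)\<^sup>2) - (expectation (\<lambda>x. x\<^sup>2))\<^sup>2"
    using integrable_pow2 integrable_pow4 by (intro variance_eq) simp_all
  then show ?thesis
    using variance_positive[of "\<lambda>x. x\<^sup>2"] by (simp add: variance_law_def fourth_moment_def)
qed

lemma m_pos: "0 < m"
  using v_pos v_sq_le_m by (meson less_le_trans zero_less_power)

section \<open>The two forms of the weight\<close>

definition S :: "nat \<Rightarrow> (nat \<Rightarrow> real) \<Rightarrow> real" where "S n x = (\<Sum>i<n. x i)"
definition T :: "nat \<Rightarrow> (nat \<Rightarrow> real) \<Rightarrow> real" where "T n x = (\<Sum>i<n. (x i)\<^sup>2)"

lemma S_measurable [measurable]: "S n \<in> borel_measurable (sample n)"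
  unfolding S_def by (intro borel_measurable_sum coordinate_measurable) simp
lemma T_measurable [measurable]: "T n \<in> borel_measurable (sample n)"
  unfolding T_def by (intro borel_measurable_sum borel_measurable_power coordinate_measurable) simp

lemma T_flip [simp]: "T n (flip j x) = T n x"
  unfolding T_def by (intro sum.cong) (auto simp: flip_def)

lemma S_square_le: "(S n x)\<^sup>2 \<le> n * T n x"
  using Cauchy_Schwarz_ineq_sum[of "\<lambda>_. 1" x "{..<n}"] by (simp add: S_def T_def)

text \<open>
  The scale \<open>\<lambda>\<close> of the mixing variable. Its fourth power is tuned so that the limiting
  density is \<open>exp (- u\<^sup>4 / 12)\<close> without further constants.
\<close>

definition scale :: "nat \<Rightarrow> real" where "scale n = (n * v\<^sup>2 / m) powr (1 / 4)"

lemma scale_pos: "n \<ge> 1 \<Longrightarrow> 0 < scale n"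
  using v_pos m_pos by (simp add: scale_def)

lemma scale_pow4: "n \<ge> 1 \<Longrightarrow> scale n ^ 4 = n * v\<^sup>2 / m"
  using v_pos m_pos by (simp add: scale_def powr_power)

lemma scale_pow2: "n \<ge> 1 \<Longrightarrow> (scale n)\<^sup>2 = sqrt n * (v / sqrt m)"
proof -
  assume n: "n \<ge> 1"
  have "(scale n)\<^sup>2 = sqrt ((scale n ^ 4))"
    by (rule real_sqrt_unique[symmetric]) simp_all
  also have "\<dots> = sqrt n * (v / sqrt m)"
    using v_pos by (simp add: scale_pow4[OF n] real_sqrt_mult real_sqrt_divide)
  finally show ?thesis .
qed

text \<open>
  The conditional mean of the mixing variable given the sample. Since \<open>x / 0 = 0\<close>, it is 0 for the
  null sample.
\<close>

definition centre :: "nat \<Rightarrow> (nat \<Rightarrow> real) \<Rightarrow> real" where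
  "centre n x = S n x / (sqrt (T n x) * scale n)"

text \<open>
  The joint density of the sample and the mixing variable before and after symmetrisation. The
  indicator of \<open>T > 0\<close> mirrors the one in the weight of the model.
\<close>

definition mixed_weight :: "nat \<Rightarrow> (nat \<Rightarrow> real) \<Rightarrow> real \<Rightarrow> real" where
  "mixed_weight n x u = indicator {0<..} (T n x) *
     exp (- (scale n * u)\<^sup>2 / 2) * exp (scale n * u / sqrt (T n x) * S n x)"

definition cosh_weight :: "nat \<Rightarrow> (nat \<Rightarrow> real) \<Rightarrow> real \<Rightarrow> real" where
  "cosh_weight n x u = indicator {0<..} (T n x) *
     exp (- (scale n * u)\<^sup>2 / 2) * (\<Prod>i<n. cosh (scale n * u / sqrt (T n x) * x i))"

text \<open>
  Completing the square: the joint density is the weight of the model times the density of a Gaussian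
  centred at \<open>centre n x\<close>.
\<close>

lemma mixed_weight_eq:
  assumes n: "n \<ge> 1"
  shows "mixed_weight n x u
    = sqrt (2 * pi) / scale n * tilde_mu_weight n x * normal_density (centre n x) (1 / scale n) u"
proof (cases "0 < T n x")
  case True
  define l where "l = scale n"
  define r where "r = S n x / sqrt (T n x)"
  have l: "0 < l" using scale_pos[OF n] by (simp add: l_def)
  have r2: "r\<^sup>2 = (S n x)\<^sup>2 / T n x" using True by (simp add: r_def power_divide)
  have c: "centre n x = r / l" by (simp add: centre_def r_def l_def)
  have "- (u - r / l)\<^sup>2 / (2 * (1 / l)\<^sup>2) = - (l * u)\<^sup>2 / 2 + l * u * r - r\<^sup>2 / 2"
    using l by (simp add: field_simps power2_eq_square)
  then have "normal_density (r / l) (1 / l) u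
      = l / sqrt (2 * pi) * exp (- (l * u)\<^sup>2 / 2 + l * u * r - r\<^sup>2 / 2)"
    using l by (simp add: normal_density_def real_sqrt_mult real_sqrt_divide power_divide)
  moreover have "tilde_mu_weight n x = exp (r\<^sup>2 / 2)"
    using True unfolding tilde_mu_weight_def r2 S_def T_def by simp
  ultimately have "sqrt (2 * pi) / l * tilde_mu_weight n x * normal_density (r / l) (1 / l) u
      = exp (r\<^sup>2 / 2) * exp (- (l * u)\<^sup>2 / 2 + l * u * r - r\<^sup>2 / 2)"
    using l by simp
  also have "\<dots> = exp (- (l * u)\<^sup>2 / 2) * exp (l * u * r)"
    by (simp flip: exp_add)
  finally show ?thesis
    using True unfolding c by (simp add: mixed_weight_def l_def r_def)
next
  case False
  then show ?thesis by (simp add: mixed_weight_def tilde_mu_weight_def T_def)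
qed

lemma cosh_weight_measurable [measurable]:
  "(\<lambda>(x, u). cosh_weight n x u) \<in> borel_measurable (sample n \<Otimes>\<^sub>M lborel)"
proof -
  have "(\<lambda>z. \<Prod>i<n. cosh (scale n * snd z / sqrt (T n (fst z)) * fst z i))
      \<in> borel_measurable (sample n \<Otimes>\<^sub>M lborel)"
  proof (rule borel_measurable_prod)
    fix i assume "i \<in> {..<n}"
    then have [measurable]: "(\<lambda>z. fst z i) \<in> borel_measurable (sample n \<Otimes>\<^sub>M lborel)"
      by (intro measurable_compose[OF measurable_fst coordinate_measurable]) auto
    show "(\<lambda>z. cosh (scale n * snd z / sqrt (T n (fst z)) * fst z i))
      \<in> borel_measurable (sample n \<Otimes>\<^sub>M lborel)"
      unfolding cosh_def by measurable
  qed
  then show ?thesis unfolding cosh_weight_def case_prod_beta by measurable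
qed

lemma mixed_weight_measurable [measurable]:
  "(\<lambda>(x, u). mixed_weight n x u) \<in> borel_measurable (sample n \<Otimes>\<^sub>M lborel)"
  unfolding mixed_weight_def by measurable

lemma cosh_weight_nonneg: "0 \<le> cosh_weight n x u"
  by (simp add: cosh_weight_def prod_nonneg)

lemma mixed_weight_nonneg: "0 \<le> mixed_weight n x u"
  by (simp add: mixed_weight_def)

text \<open>
  Because the \<open>t\<^sub>i\<close> are normalised by \<open>\<surd>T\<close>, the Gaussian factor is exactly the product of the factors
  \<open>exp (- t\<^sub>i\<^sup>2 / 2)\<close>, for every sample; this removes the quadratic part of \<open>ln cosh\<close>.
\<close>

lemma cosh_weight_eq_exp:
  fixes u :: real
  assumes "0 < T n x"
  defines "t \<equiv> \<lambda>i. scale n * u / sqrt (T n x) * x i"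
  shows "cosh_weight n x u = exp (\<Sum>i<n. ln (cosh (t i)) - (t i)\<^sup>2 / 2)"
    and "(\<Sum>i<n. (t i)\<^sup>2) = (scale n * u)\<^sup>2"
proof -
  show *: "(\<Sum>i<n. (t i)\<^sup>2) = (scale n * u)\<^sup>2"
  proof -
    have "(t i)\<^sup>2 = (scale n * u)\<^sup>2 / T n x * (x i)\<^sup>2" for i
      using assms(1) by (simp add: t_def power_mult_distrib power_divide)
    then have "(\<Sum>i<n. (t i)\<^sup>2) = (scale n * u)\<^sup>2 / T n x * T n x"
      by (simp add: T_def sum_distrib_left)
    then show ?thesis using assms(1) by simp
  qed
  have "cosh_weight n x u = exp (- (\<Sum>i<n. (t i)\<^sup>2) / 2) * (\<Prod>i<n. exp (ln (cosh (t i))))"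
    unfolding * using assms(1) by (simp add: cosh_weight_def t_def)
  also have "\<dots> = exp (\<Sum>i<n. ln (cosh (t i)) - (t i)\<^sup>2 / 2)"
    by (simp only: exp_sum[symmetric, OF finite_lessThan] exp_add[symmetric])
       (simp add: sum_subtractf sum_divide_distrib)
  finally show "cosh_weight n x u = exp (\<Sum>i<n. ln (cosh (t i)) - (t i)\<^sup>2 / 2)" .
qed

lemma cosh_weight_le_1: "cosh_weight n x u \<le> 1"
proof (cases "0 < T n x")
  case True
  have "ln (cosh t) - t\<^sup>2 / 2 \<le> 0" for t :: real
  proof -
    have "- ((t\<^sup>2)\<^sup>2 / (1 + t\<^sup>2)) / 24 \<le> 0" by simp
    with ln_cosh_le_subgaussian[of t] show ?thesis by (rule order_trans)
  qed
  then show ?thesis unfolding cosh_weight_eq_exp(1)[OF True] by (simp add: sum_nonpos)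
qed (simp add: cosh_weight_def)

text \<open>
  An upper bound for the symmetrised weight in which neither the sample nor \<open>n\<close> appears.
\<close>

definition envelope :: "real \<Rightarrow> real" where
  "envelope u = exp ((1 - v / sqrt m * u\<^sup>2) / 24)"

text \<open>
  By Jensen the gain over the Gaussian bound is smallest when all \<open>t\<^sub>i\<^sup>2\<close> are equal, and then
  it is \<open>a\<^sup>2 / (1 + a / \<surd>n)\<close> with \<open>a\<close> a multiple of \<open>u\<^sup>2\<close>. This increases with \<open>n\<close>, hence is at
  least its value \<open>a\<^sup>2 / (1 + a) \<ge> a - 1\<close> at \<open>n = 1\<close>.
\<close>

lemma cosh_weight_le_envelope:
  assumes n: "n \<ge> 1"
  shows "cosh_weight n x u \<le> envelope u"
proof (cases "0 < T n x")
  case True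
  define t where "t i = scale n * u / sqrt (T n x) * x i" for i
  define a where "a = v / sqrt m * u\<^sup>2"
  have a: "0 \<le> a" using v_pos m_pos by (simp add: a_def)
  have t2: "(\<Sum>i<n. (t i)\<^sup>2) = sqrt n * a"
    using cosh_weight_eq_exp(2)[OF True] scale_pow2[OF n]
    by (simp add: t_def a_def power_mult_distrib)
  have sq: "1 \<le> sqrt n" using n by simp
  have "a - 1 \<le> a\<^sup>2 / (1 + a)"
  proof -
    have "(a - 1) * (1 + a) \<le> a\<^sup>2" by (simp add: algebra_simps power2_eq_square)
    then show ?thesis using a by (simp add: pos_le_divide_eq)
  qed
  also have "\<dots> \<le> a\<^sup>2 / (1 + a / sqrt n)"
  proof (intro divide_left_mono mult_pos_pos add_left_mono add_pos_nonneg)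
    show "a / sqrt n \<le> a" using a sq by (simp add: divide_le_eq mult_le_cancel_left1)
  qed (use a in auto)
  also have "\<dots> = (sqrt n * a)\<^sup>2 / (n + sqrt n * a)"
  proof -
    have "n + sqrt n * a = n * (1 + a / sqrt n)"
      using n by (simp add: field_simps)
    then show ?thesis using n by (simp add: power_mult_distrib)
  qed
  also have "\<dots> \<le> (\<Sum>i<n. ((t i)\<^sup>2)\<^sup>2 / (1 + (t i)\<^sup>2))"
    using sum_square_div_ge[of "{..<n}" "\<lambda>i. (t i)\<^sup>2"] by (simp add: t2)
  finally have *: "a - 1 \<le> (\<Sum>i<n. ((t i)\<^sup>2)\<^sup>2 / (1 + (t i)\<^sup>2))" .
  have "(\<Sum>i<n. ln (cosh (t i)) - (t i)\<^sup>2 / 2) \<le> (\<Sum>i<n. - (((t i)\<^sup>2)\<^sup>2 / (1 + (t i)\<^sup>2)) / 24)"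
  proof (rule sum_mono)
    fix i
    show "ln (cosh (t i)) - (t i)\<^sup>2 / 2 \<le> - (((t i)\<^sup>2)\<^sup>2 / (1 + (t i)\<^sup>2)) / 24"
      by (rule ln_cosh_le_subgaussian)
  qed
  also have "\<dots> = - (\<Sum>i<n. ((t i)\<^sup>2)\<^sup>2 / (1 + (t i)\<^sup>2)) / 24"
    by (simp add: sum_negf sum_divide_distrib)
  also have "\<dots> \<le> (1 - a) / 24" using * by simp
  finally show ?thesis
    unfolding cosh_weight_eq_exp(1)[OF True] envelope_def t_def a_def by simp
qed (simp add: cosh_weight_def envelope_def)

lemma tilde_mu_weight_measurable [measurable]:
  "tilde_mu_weight n \<in> borel_measurable (sample n)"
proof -
  have "tilde_mu_weight n = (\<lambda>x. exp (1 / 2 * ((S n x)\<^sup>2 / T n x)) * indicator {0<..} (T n x))"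
    by (auto simp: fun_eq_iff tilde_mu_weight_def S_def T_def indicator_def)
  then show ?thesis by simp
qed

lemma tilde_mu_weight_nonneg: "0 \<le> tilde_mu_weight n x"
  by (simp add: tilde_mu_weight_def)

lemma envelope_measurable [measurable]: "envelope \<in> borel_measurable borel"
  unfolding envelope_def[abs_def] by measurable

lemma envelope_nonneg: "0 \<le> envelope u" by (simp add: envelope_def)

lemma envelope_integrable: "integrable lborel (\<lambda>u. (1 + \<bar>u\<bar>) * envelope u)"
proof -
  define k where "k = v / sqrt m"
  define s where "s = sqrt (12 / k)"
  have k: "0 < k" using v_pos m_pos by (simp add: k_def)
  then have s: "0 < s" by (simp add: s_def)
  have eq: "envelope u = exp (1 / 24) * sqrt (2 * pi * s\<^sup>2) * normal_density 0 s u" for u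
  proof -
    have "(1 - k * u\<^sup>2) / 24 = 1 / 24 + - u\<^sup>2 / (2 * s\<^sup>2)"
      using k by (simp add: s_def field_simps)
    then have "envelope u = exp (1 / 24) * exp (- u\<^sup>2 / (2 * s\<^sup>2))"
      by (simp add: envelope_def k_def flip: exp_add)
    then show ?thesis using s by (simp add: normal_density_def)
  qed
  have "integrable lborel (\<lambda>u. normal_density 0 s u * \<bar>u - 0\<bar> ^ 0 + normal_density 0 s u * \<bar>u - 0\<bar> ^ 1)"
    using s by (intro Bochner_Integration.integrable_add integrable_normal_moment_abs)
  then have "integrable lborel (\<lambda>u. exp (1 / 24) * sqrt (2 * pi * s\<^sup>2)
      * (normal_density 0 s u * \<bar>u - 0\<bar> ^ 0 + normal_density 0 s u * \<bar>u - 0\<bar> ^ 1))"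
    by (rule integrable_mult_right)
  then show ?thesis unfolding eq by (rule Bochner_Integration.integrable_cong[THEN iffD1, rotated -1]) (auto simp: algebra_simps)
qed

lemma
  shows envelope_integrable_0: "integrable lborel envelope"
    and envelope_integrable_1: "integrable lborel (\<lambda>u. \<bar>u\<bar> * envelope u)"
proof -
  have le: "norm (envelope u) \<le> norm ((1 + \<bar>u\<bar>) * envelope u)"
    "norm (\<bar>u\<bar> * envelope u) \<le> norm ((1 + \<bar>u\<bar>) * envelope u)" for u
    using envelope_nonneg[of u] by (simp_all add: abs_mult distrib_right)
  show "integrable lborel envelope" "integrable lborel (\<lambda>u. \<bar>u\<bar> * envelope u)"
    using le by (auto intro!: Bochner_Integration.integrable_bound[OF envelope_integrable])
qed

section \<open>The Gaussian mixture\<close>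

lemma pair_sigma_finite_sample: "pair_sigma_finite (sample n) lborel"
proof -
  interpret P: prob_space "sample n" by (rule prob_space_iid)
  show ?thesis
    by (simp add: pair_sigma_finite_def P.sigma_finite_measure_axioms sigma_finite_lborel)
qed

text \<open>
  Fubini, and symmetrisation for each fixed \<open>u\<close>. The statement is in terms of nonnegative integrals,
  so that integrability of the left-hand side can be read off from the right-hand side, where the
  envelope is available.
\<close>

lemma mixture_swap:
  fixes \<psi> :: "(nat \<Rightarrow> real) \<Rightarrow> real \<Rightarrow> real"
  assumes \<psi>: "(\<lambda>(x, u). \<psi> x u) \<in> borel_measurable (sample n \<Otimes>\<^sub>M lborel)"
    and nonneg: "\<And>x u. 0 \<le> \<psi> x u"
    and even: "\<And>j x u. j < n \<Longrightarrow> \<psi> (flip j x) u = \<psi> x u"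
  shows "(\<integral>\<^sup>+z. ennreal (\<psi> (fst z) (snd z) * mixed_weight n (fst z) (snd z)) \<partial>(sample n \<Otimes>\<^sub>M lborel))
    = (\<integral>\<^sup>+z. ennreal (\<psi> (fst z) (snd z) * cosh_weight n (fst z) (snd z)) \<partial>(sample n \<Otimes>\<^sub>M lborel))"
proof -
  interpret pair_sigma_finite "sample n" lborel by (rule pair_sigma_finite_sample)
  have [measurable]: "(\<lambda>z. \<psi> (fst z) (snd z)) \<in> borel_measurable (sample n \<Otimes>\<^sub>M lborel)"
    "(\<lambda>z. mixed_weight n (fst z) (snd z)) \<in> borel_measurable (sample n \<Otimes>\<^sub>M lborel)"
    "(\<lambda>z. cosh_weight n (fst z) (snd z)) \<in> borel_measurable (sample n \<Otimes>\<^sub>M lborel)"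
    using \<psi> mixed_weight_measurable cosh_weight_measurable by (simp_all add: case_prod_beta')
  have [measurable]: "(\<lambda>x. \<psi> x u) \<in> borel_measurable (sample n)" for u
    using measurable_Pair1[OF \<psi>, of u] by simp
  have "(\<integral>\<^sup>+x. ennreal (\<psi> x u * mixed_weight n x u) \<partial>sample n)
      = (\<integral>\<^sup>+x. ennreal (\<psi> x u * cosh_weight n x u) \<partial>sample n)" for u
  proof -
    define k where "k x = \<psi> x u * indicator {0<..} (T n x) * exp (- (scale n * u)\<^sup>2 / 2)" for x
    define b where "b x = scale n * u / sqrt (T n x)" for x
    have "(\<integral>\<^sup>+x. ennreal (k x * exp (b x * (\<Sum>i<n. x i))) \<partial>sample n)
      = (\<integral>\<^sup>+x. ennreal (k x * (\<Prod>i<n. cosh (b x * x i))) \<partial>sample n)"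
    proof (rule symmetrisation)
      show "k \<in> borel_measurable (sample n)" unfolding k_def by measurable
      show "b \<in> borel_measurable (sample n)" unfolding b_def by measurable
    qed (auto simp: k_def b_def nonneg even)
    then show ?thesis
      by (simp add: k_def b_def mixed_weight_def cosh_weight_def S_def mult.assoc)
  qed
  then have "(\<integral>\<^sup>+u. \<integral>\<^sup>+x. ennreal (\<psi> x u * mixed_weight n x u) \<partial>sample n \<partial>lborel)
      = (\<integral>\<^sup>+u. \<integral>\<^sup>+x. ennreal (\<psi> x u * cosh_weight n x u) \<partial>sample n \<partial>lborel)"
    by simp
  then show ?thesis by (subst (1 2) nn_integral_snd[symmetric]) auto
qed

text \<open>
  The total mass of the Gaussian factor before it is normalised to a probability density.
\<close>

definition mix_const :: "nat \<Rightarrow> real" where "mix_const n = sqrt (2 * pi) / scale n"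

abbreviation centred_normal :: "nat \<Rightarrow> (nat \<Rightarrow> real) \<Rightarrow> real \<Rightarrow> real" where
  "centred_normal n x \<equiv> normal_density (centre n x) (1 / scale n)"

text \<open>
  The exchange formula on which everything rests: the integral on the left is taken with respect to
  the weight of the model, the one on the right with respect to the symmetrised weight, which has a
  limit. All test functions that are needed grow at most linearly in \<open>u\<close>, and \<open>B\<close> controls their
  dependence on the sample.
\<close>

lemma
  fixes \<psi> :: "(nat \<Rightarrow> real) \<Rightarrow> real \<Rightarrow> real"
  assumes n: "n \<ge> 1"
    and \<psi>: "(\<lambda>(x, u). \<psi> x u) \<in> borel_measurable (sample n \<Otimes>\<^sub>M lborel)"
    and nonneg: "\<And>x u. 0 \<le> \<psi> x u"
    and even: "\<And>j x u. j < n \<Longrightarrow> \<psi> (flip j x) u = \<psi> x u"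
    and B: "integrable (sample n) B" "\<And>x u. \<psi> x u \<le> B x * (1 + \<bar>u\<bar>)"
  shows mixture_integrable_cosh:
      "integrable (sample n \<Otimes>\<^sub>M lborel) (\<lambda>(x, u). \<psi> x u * cosh_weight n x u)"
    and mixture_integrable:
      "integrable (sample n) (\<lambda>x. mix_const n * tilde_mu_weight n x * (\<integral>u. \<psi> x u * centred_normal n x u \<partial>lborel))"
    and mixture_integral:
      "(\<integral>x. mix_const n * tilde_mu_weight n x * (\<integral>u. \<psi> x u * centred_normal n x u \<partial>lborel) \<partial>sample n)
        = (\<integral>u. (\<integral>x. \<psi> x u * cosh_weight n x u \<partial>sample n) \<partial>lborel)"
proof -
  interpret pair_sigma_finite "sample n" lborel by (rule pair_sigma_finite_sample)
  have m[measurable]: "(\<lambda>z. \<psi> (fst z) (snd z)) \<in> borel_measurable (sample n \<Otimes>\<^sub>M lborel)"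
    "(\<lambda>z. mixed_weight n (fst z) (snd z)) \<in> borel_measurable (sample n \<Otimes>\<^sub>M lborel)"
    "(\<lambda>z. cosh_weight n (fst z) (snd z)) \<in> borel_measurable (sample n \<Otimes>\<^sub>M lborel)"
    using \<psi> mixed_weight_measurable cosh_weight_measurable by (simp_all add: case_prod_beta')
  have [measurable]: "B \<in> borel_measurable (sample n)" using B by auto
  let ?C = "\<lambda>z. \<psi> (fst z) (snd z) * cosh_weight n (fst z) (snd z)"
  let ?M = "\<lambda>z. \<psi> (fst z) (snd z) * mixed_weight n (fst z) (snd z)"
  have int_B: "integrable (sample n \<Otimes>\<^sub>M lborel) (\<lambda>z. B (fst z) * ((1 + \<bar>snd z\<bar>) * envelope (snd z)))"
  proof (rule Fubini_integrable)
    show "AE x in sample n. integrable lborel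
        (\<lambda>y. B (fst (x, y)) * ((1 + \<bar>snd (x, y)\<bar>) * envelope (snd (x, y))))"
      using envelope_integrable by auto
    show "integrable (sample n) (\<lambda>x. LINT y|lborel.
        norm (B (fst (x, y)) * ((1 + \<bar>snd (x, y)\<bar>) * envelope (snd (x, y)))))"
      using B(1) by (simp add: abs_mult)
  qed measurable
  have int_C: "integrable (sample n \<Otimes>\<^sub>M lborel) ?C"
    using int_B
  proof (rule Bochner_Integration.integrable_bound)
    have "\<psi> x u * cosh_weight n x u \<le> B x * ((1 + \<bar>u\<bar>) * envelope u)" for x u
    proof -
      have "\<psi> x u * cosh_weight n x u \<le> (B x * (1 + \<bar>u\<bar>)) * envelope u"
        using order_trans[OF nonneg B(2)]
        by (intro mult_mono B cosh_weight_le_envelope n cosh_weight_nonneg)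
      then show ?thesis by (simp add: mult.assoc)
    qed
    then show "AE z in sample n \<Otimes>\<^sub>M lborel. norm (?C z) \<le> norm (B (fst z) * ((1 + \<bar>snd z\<bar>) * envelope (snd z)))"
      by (intro AE_I2) (simp add: nonneg cosh_weight_nonneg order_trans[OF _ abs_ge_self] del: abs_mult)
  qed measurable
  then show "integrable (sample n \<Otimes>\<^sub>M lborel) (\<lambda>(x, u). \<psi> x u * cosh_weight n x u)"
    by (simp add: case_prod_beta')
  have nn: "(\<integral>\<^sup>+z. ennreal (?M z) \<partial>(sample n \<Otimes>\<^sub>M lborel)) = (\<integral>\<^sup>+z. ennreal (?C z) \<partial>(sample n \<Otimes>\<^sub>M lborel))"
    by (rule mixture_swap[OF \<psi> nonneg even])
  have int_M: "integrable (sample n \<Otimes>\<^sub>M lborel) ?M"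
  proof (rule integrableI_nonneg)
    have "(\<integral>\<^sup>+z. ennreal (?C z) \<partial>(sample n \<Otimes>\<^sub>M lborel)) = ennreal (\<integral>z. ?C z \<partial>(sample n \<Otimes>\<^sub>M lborel))"
      using int_C by (rule nn_integral_eq_integral) (simp add: nonneg cosh_weight_nonneg)
    then show "(\<integral>\<^sup>+z. ennreal (?M z) \<partial>(sample n \<Otimes>\<^sub>M lborel)) < \<infinity>" by (simp add: nn)
  qed (auto simp: nonneg mixed_weight_nonneg)
  have inner: "mix_const n * tilde_mu_weight n x * (\<integral>u. \<psi> x u * centred_normal n x u \<partial>lborel)
      = (\<integral>u. ?M (x, u) \<partial>lborel)" for x
    by (subst integral_mult_right_zero[symmetric])
       (simp add: mixed_weight_eq[OF n] mix_const_def mult_ac)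
  show "integrable (sample n) (\<lambda>x. mix_const n * tilde_mu_weight n x * (\<integral>u. \<psi> x u * centred_normal n x u \<partial>lborel))"
    unfolding inner by (rule integrable_fst'[OF int_M])
  have "(\<integral>x. mix_const n * tilde_mu_weight n x * (\<integral>u. \<psi> x u * centred_normal n x u \<partial>lborel) \<partial>sample n)
      = (\<integral>z. ?M z \<partial>(sample n \<Otimes>\<^sub>M lborel))"
    unfolding inner by (rule integral_fst'[OF int_M])
  also have "\<dots> = (\<integral>z. ?C z \<partial>(sample n \<Otimes>\<^sub>M lborel))"
    by (subst (1 2) integral_eq_nn_integral) (auto simp: nn nonneg mixed_weight_nonneg cosh_weight_nonneg)
  also have "\<dots> = (\<integral>u. (\<integral>x. \<psi> x u * cosh_weight n x u \<partial>sample n) \<partial>lborel)"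
    using integral_snd[of "\<lambda>x u. \<psi> x u * cosh_weight n x u"] int_C by (simp add: case_prod_beta')
  finally show "(\<integral>x. mix_const n * tilde_mu_weight n x * (\<integral>u. \<psi> x u * centred_normal n x u \<partial>lborel) \<partial>sample n)
        = (\<integral>u. (\<integral>x. \<psi> x u * cosh_weight n x u \<partial>sample n) \<partial>lborel)" .
qed

section \<open>Limit of the density of the mixing variable\<close>

definition avg :: "(real \<Rightarrow> real) \<Rightarrow> nat \<Rightarrow> (nat \<Rightarrow> real) \<Rightarrow> real" where
  "avg q n x = (\<Sum>i<n. q (x i)) / n"

lemma T_eq_avg: "n \<ge> 1 \<Longrightarrow> T n x = n * avg (\<lambda>y. y\<^sup>2) n x"
  by (simp add: avg_def T_def)

text \<open>
  The bound is linear in the empirical moments and their deviations, so that it can be integrated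
  term by term. On the event \<open>\<tau> \<ge> v / 2\<close> it comes from the expansion of \<open>ln cosh\<close>; on the
  complement the left-hand side is at most 1, while \<open>2 / v * |\<tau> - v|\<close> is at least 1.
\<close>

lemma cosh_weight_approx:
  fixes n x u
  assumes n: "n \<ge> 1"
  defines "\<tau> \<equiv> avg (\<lambda>y. y\<^sup>2) n x" and "\<alpha> \<equiv> avg (\<lambda>y. y ^ 4) n x" and "\<beta> \<equiv> avg (\<lambda>y. y ^ 6) n x"
  shows "\<bar>cosh_weight n x u - exp (- (u ^ 4) / 12)\<bar>
    \<le> 2 / v * \<bar>\<tau> - v\<bar> + u ^ 4 / 12 * (4 / m * \<bar>\<alpha> - m\<bar> + 6 / v * \<bar>\<tau> - v\<bar>)
      + 8 * (v / sqrt m) ^ 3 * u ^ 6 / (45 * v ^ 3) * (\<beta> / sqrt n)"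
    (is "?lhs \<le> ?a + ?b + ?c")
proof -
  have \<beta>: "0 \<le> \<beta>" by (auto simp: \<beta>_def avg_def intro!: divide_nonneg_nonneg sum_nonneg)
  have a0: "0 \<le> ?a" using v_pos by simp
  have b0: "0 \<le> ?b" using v_pos m_pos by (intro mult_nonneg_nonneg add_nonneg_nonneg) auto
  have c0: "0 \<le> ?c" using v_pos m_pos \<beta>
    by (intro mult_nonneg_nonneg divide_nonneg_nonneg) auto
  show ?thesis
  proof (cases "v / 2 \<le> \<tau>")
    case False
    then have "1 \<le> ?a" using v_pos by (simp add: field_simps abs_if)
    moreover have "?lhs \<le> 1"
    proof -
      have "exp (- (u ^ 4) / 12) \<le> 1" "0 < exp (- (u ^ 4) / 12)" by simp_all
      then show ?thesis
        using cosh_weight_nonneg[of n x u] cosh_weight_le_1[of n x u] by linarith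
    qed
    ultimately show ?thesis using b0 c0 by linarith
  next
    case True
    then have \<tau>: "0 < \<tau>" using v_pos by linarith
    have Tn: "T n x = n * \<tau>" using T_eq_avg[OF n] by (simp add: \<tau>_def)
    have T: "0 < T n x" using \<tau> n by (simp add: Tn)
    define t where "t i = scale n * u / sqrt (T n x) * x i" for i
    define e where "e = (\<Sum>i<n. (t i)\<^sup>2 / 2 - ln (cosh (t i)))"
    have weight: "cosh_weight n x u = exp (- e)"
      unfolding cosh_weight_eq_exp(1)[OF T] by (simp add: e_def t_def flip: sum_negf)
    have t_pow: "(t i) ^ (2 * k) = ((scale n)\<^sup>2) ^ k * u ^ (2 * k) / T n x ^ k * x i ^ (2 * k)" for i k
    proof -
      have "(t i)\<^sup>2 = (scale n)\<^sup>2 * u\<^sup>2 / T n x * (x i)\<^sup>2"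
        using T by (simp add: t_def power_mult_distrib power_divide)
      then show ?thesis by (simp add: power_mult power_mult_distrib power_divide)
    qed
    have s4: "(\<Sum>i<n. (t i) ^ 4) = u ^ 4 * (v\<^sup>2 * \<alpha> / (m * \<tau>\<^sup>2))"
    proof -
      have "((scale n)\<^sup>2)\<^sup>2 = n * v\<^sup>2 / m" using scale_pow4[OF n] by simp
      then have "(t i) ^ 4 = n * v\<^sup>2 / m * u ^ 4 / (n * \<tau>)\<^sup>2 * x i ^ 4" for i
        using t_pow[of i 2] by (simp add: Tn)
      then have "(\<Sum>i<n. (t i) ^ 4) = n * v\<^sup>2 / m * u ^ 4 / (n * \<tau>)\<^sup>2 * (n * \<alpha>)"
        using n by (simp add: \<alpha>_def avg_def sum_distrib_left sum_divide_distrib)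
      also have "\<dots> = u ^ 4 * (v\<^sup>2 * \<alpha> / (m * \<tau>\<^sup>2))"
        using n \<tau> m_pos by (simp add: field_simps power2_eq_square)
      finally show ?thesis .
    qed
    have s6: "(\<Sum>i<n. (t i) ^ 6) = (v / sqrt m) ^ 3 * u ^ 6 * (\<beta> / sqrt n) / \<tau> ^ 3"
    proof -
      have "(t i) ^ 6 = (sqrt n * (v / sqrt m)) ^ 3 * u ^ 6 / (n * \<tau>) ^ 3 * x i ^ 6" for i
        using t_pow[of i 3] by (simp add: Tn scale_pow2[OF n])
      then have "(\<Sum>i<n. (t i) ^ 6) = (sqrt n * (v / sqrt m)) ^ 3 * u ^ 6 / (n * \<tau>) ^ 3 * (n * \<beta>)"
        using n by (simp add: \<beta>_def avg_def sum_distrib_left sum_divide_distrib)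
      also have "\<dots> = (v / sqrt m) ^ 3 * u ^ 6 * \<beta> / \<tau> ^ 3 * (sqrt n ^ 3 * real n / real n ^ 3)"
        by (simp add: power_mult_distrib power_divide mult_ac)
      also have "sqrt n ^ 3 * real n / real n ^ 3 = 1 / sqrt n"
      proof -
        define r where "r = sqrt n"
        have "0 < r" "real n = r\<^sup>2" using n by (simp_all add: r_def)
        then show ?thesis unfolding r_def[symmetric]
          by (simp add: power2_eq_square power3_eq_cube)
      qed
      finally show ?thesis by simp
    qed
    have "0 \<le> e"
      unfolding e_def
    proof (rule sum_nonneg)
      fix i
      have "- (((t i)\<^sup>2)\<^sup>2 / (1 + (t i)\<^sup>2)) / 24 \<le> 0" by simp
      with ln_cosh_le_subgaussian[of "t i"] have "ln (cosh (t i)) - (t i)\<^sup>2 / 2 \<le> 0" by (rule order_trans)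
      then show "0 \<le> (t i)\<^sup>2 / 2 - ln (cosh (t i))" by simp
    qed
    then have "?lhs \<le> \<bar>e - u ^ 4 / 12\<bar>"
      using abs_exp_diff_le[of e "u ^ 4 / 12"] by (simp add: weight)
    also have "\<dots> \<le> \<bar>(\<Sum>i<n. (t i) ^ 4) / 12 - u ^ 4 / 12\<bar> + (\<Sum>i<n. (t i) ^ 6) / 45"
    proof -
      have "e \<le> (\<Sum>i<n. (t i) ^ 4 / 12)"
        unfolding e_def
      proof (rule sum_mono)
        fix i show "(t i)\<^sup>2 / 2 - ln (cosh (t i)) \<le> (t i) ^ 4 / 12"
          using ln_cosh_ge[of "t i"] by linarith
      qed
      moreover have "(\<Sum>i<n. (t i) ^ 4 / 12 - (t i) ^ 6 / 45) \<le> e"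
        unfolding e_def
      proof (rule sum_mono)
        fix i show "(t i) ^ 4 / 12 - (t i) ^ 6 / 45 \<le> (t i)\<^sup>2 / 2 - ln (cosh (t i))"
          using ln_cosh_le[of "t i"] by linarith
      qed
      moreover have "0 \<le> (\<Sum>i<n. (t i) ^ 6)" by (intro sum_nonneg) simp
      ultimately show ?thesis
        by (simp add: sum_subtractf flip: sum_divide_distrib)
    qed
    also have "\<bar>(\<Sum>i<n. (t i) ^ 4) / 12 - u ^ 4 / 12\<bar> = u ^ 4 / 12 * \<bar>v\<^sup>2 * \<alpha> / (m * \<tau>\<^sup>2) - 1\<bar>"
    proof -
      have "(\<Sum>i<n. (t i) ^ 4) / 12 - u ^ 4 / 12 = u ^ 4 / 12 * (v\<^sup>2 * \<alpha> / (m * \<tau>\<^sup>2) - 1)"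
        by (simp add: s4 right_diff_distrib)
      then show ?thesis by (simp only: abs_mult) simp
    qed
    also have "u ^ 4 / 12 * \<bar>v\<^sup>2 * \<alpha> / (m * \<tau>\<^sup>2) - 1\<bar> \<le> ?b"
    proof (intro mult_left_mono)
      have q: "v\<^sup>2 / \<tau>\<^sup>2 \<le> 4"
      proof -
        have "v / \<tau> \<le> 2" using True \<tau> by (simp add: field_simps)
        then have "(v / \<tau>)\<^sup>2 \<le> 2\<^sup>2" using v_pos \<tau> by (intro power_mono) auto
        then show ?thesis by (simp add: power_divide)
      qed
      have "v\<^sup>2 * \<alpha> / (m * \<tau>\<^sup>2) - 1 = v\<^sup>2 / \<tau>\<^sup>2 / m * (\<alpha> - m) + (v\<^sup>2 / \<tau>\<^sup>2 / v + 1 / \<tau>) * (v - \<tau>)"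
        using \<tau> m_pos v_pos by (simp add: field_simps power2_eq_square)
      also have "\<bar>\<dots>\<bar> \<le> v\<^sup>2 / \<tau>\<^sup>2 / m * \<bar>\<alpha> - m\<bar> + (v\<^sup>2 / \<tau>\<^sup>2 / v + 1 / \<tau>) * \<bar>\<tau> - v\<bar>"
      proof (rule order_trans[OF abs_triangle_ineq])
        have "0 \<le> v\<^sup>2 / \<tau>\<^sup>2 / m" "0 \<le> v\<^sup>2 / \<tau>\<^sup>2 / v + 1 / \<tau>" using \<tau> v_pos m_pos by auto
        then show "\<bar>v\<^sup>2 / \<tau>\<^sup>2 / m * (\<alpha> - m)\<bar> + \<bar>(v\<^sup>2 / \<tau>\<^sup>2 / v + 1 / \<tau>) * (v - \<tau>)\<bar>
          \<le> v\<^sup>2 / \<tau>\<^sup>2 / m * \<bar>\<alpha> - m\<bar> + (v\<^sup>2 / \<tau>\<^sup>2 / v + 1 / \<tau>) * \<bar>\<tau> - v\<bar>"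
          by (simp only: abs_mult abs_of_nonneg abs_minus_commute[of v \<tau>])
      qed
      also have "\<dots> \<le> 4 / m * \<bar>\<alpha> - m\<bar> + 6 / v * \<bar>\<tau> - v\<bar>"
      proof (intro add_mono mult_right_mono)
        show "v\<^sup>2 / \<tau>\<^sup>2 / m \<le> 4 / m" using q m_pos by (intro divide_right_mono) auto
        have "v\<^sup>2 / \<tau>\<^sup>2 / v \<le> 4 / v" using q v_pos by (intro divide_right_mono) auto
        moreover have "1 / \<tau> \<le> 2 / v" using True \<tau> v_pos by (simp add: field_simps)
        moreover have "6 / v = 4 / v + 2 / v" by (simp add: add_divide_distrib[symmetric])
        ultimately show "v\<^sup>2 / \<tau>\<^sup>2 / v + 1 / \<tau> \<le> 6 / v" by linarith
      qed auto
      finally show "\<bar>v\<^sup>2 * \<alpha> / (m * \<tau>\<^sup>2) - 1\<bar> \<le> 4 / m * \<bar>\<alpha> - m\<bar> + 6 / v * \<bar>\<tau> - v\<bar>" .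
    qed simp
    also have "(\<Sum>i<n. (t i) ^ 6) / 45 \<le> ?c"
    proof -
      have "(v / 2) ^ 3 \<le> \<tau> ^ 3" using True v_pos by (intro power_mono) auto
      then have "(\<Sum>i<n. (t i) ^ 6) \<le> (v / sqrt m) ^ 3 * u ^ 6 * (\<beta> / sqrt n) / (v / 2) ^ 3"
        unfolding s6 using v_pos m_pos \<beta> \<tau>
        by (intro divide_left_mono mult_nonneg_nonneg mult_pos_pos) auto
      then show ?thesis using v_pos by (simp add: field_simps)
    qed
    finally show ?thesis using a0 by linarith
  qed
qed

text \<open>
  The density of the mixing variable, up to normalisation.
\<close>

definition profile :: "nat \<Rightarrow> real \<Rightarrow> real" where
  "profile n u = (\<integral>x. cosh_weight n x u \<partial>sample n)"

lemma cosh_weight_integrable: "integrable (sample n) (\<lambda>x. cosh_weight n x u)"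
proof -
  interpret P: prob_space "sample n" by (rule prob_space_iid)
  have "(\<lambda>x. cosh_weight n x u) \<in> borel_measurable (sample n)"
    using measurable_Pair1[OF cosh_weight_measurable[of n], of u] by simp
  then show ?thesis
    by (rule P.integrable_const_bound[where B = 1, rotated])
       (simp add: cosh_weight_nonneg cosh_weight_le_1)
qed

lemma profile_tendsto: "(\<lambda>n. profile n u) \<longlonglongrightarrow> exp (- (u ^ 4) / 12)"
proof -
  define V2 where "V2 = variance (\<lambda>y. y\<^sup>2)"
  define V4 where "V4 = variance (\<lambda>y. y ^ 4)"
  define m6 where "m6 = expectation (\<lambda>y. y ^ 6)"
  define c where "c = 8 * (v / sqrt m) ^ 3 * u ^ 6 / (45 * v ^ 3)"
  define bd where "bd n = 2 / v * sqrt (V2 / n) + u ^ 4 / 12 * (4 / m * sqrt (V4 / n) + 6 / v * sqrt (V2 / n))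
      + c * (m6 / sqrt n)" for n :: nat
  have meas: "(\<lambda>y. y ^ k) \<in> borel_measurable \<rho>" for k
    by (simp add: measurable_cong_sets[OF sets_law refl])
  have int4: "integrable \<rho> (\<lambda>y. (y\<^sup>2)\<^sup>2)" using integrable_pow4 by simp
  have int8: "integrable \<rho> (\<lambda>y. (y ^ 4)\<^sup>2)" using eighth_moment by simp
  have "\<bar>profile n u - exp (- (u ^ 4) / 12)\<bar> \<le> bd n" if n: "n \<ge> 1" for n
  proof -
    interpret P: prob_space "sample n" by (rule prob_space_iid)
    define D2 where "D2 x = \<bar>avg (\<lambda>y. y\<^sup>2) n x - v\<bar>" for x
    define D4 where "D4 x = \<bar>avg (\<lambda>y. y ^ 4) n x - m\<bar>" for x
    define A6 where "A6 x = avg (\<lambda>y. y ^ 6) n x" for x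
    have D2: "integrable (sample n) D2" "(\<integral>x. D2 x \<partial>sample n) \<le> sqrt (V2 / n)"
      using weak_law_L1[OF meas int4 n]
      by (simp_all add: D2_def[abs_def] avg_def variance_law_def V2_def)
    have D4: "integrable (sample n) D4" "(\<integral>x. D4 x \<partial>sample n) \<le> sqrt (V4 / n)"
      using weak_law_L1[OF meas int8 n]
      by (simp_all add: D4_def[abs_def] avg_def fourth_moment_def V4_def)
    have A6: "integrable (sample n) A6" "(\<integral>x. A6 x \<partial>sample n) = m6"
    proof -
      have c: "integrable (sample n) (\<lambda>x. x i ^ 6)" "(\<integral>x. x i ^ 6 \<partial>sample n) = m6" if "i < n" for i
        using integrable_iid_component[OF that integrable_pow6]
          integral_iid_component[OF that integrable_pow6] by (simp_all add: m6_def)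
      show "integrable (sample n) A6"
        unfolding A6_def avg_def using c by (intro integrable_divide Bochner_Integration.integrable_sum) auto
      have "(\<integral>x. (\<Sum>i<n. x i ^ 6) \<partial>sample n) = (\<Sum>i<n. m6)"
        using c by (subst Bochner_Integration.integral_sum) auto
      then show "(\<integral>x. A6 x \<partial>sample n) = m6"
        unfolding A6_def avg_def using n by simp
    qed
    have "profile n u - exp (- (u ^ 4) / 12) = (\<integral>x. cosh_weight n x u - exp (- (u ^ 4) / 12) \<partial>sample n)"
      unfolding profile_def
      by (subst Bochner_Integration.integral_diff) (auto simp: cosh_weight_integrable P.prob_space)
    also have "\<bar>\<dots>\<bar> \<le> (\<integral>x. \<bar>cosh_weight n x u - exp (- (u ^ 4) / 12)\<bar> \<partial>sample n)"
      by (rule integral_abs_bound)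
    also have "\<dots> \<le> (\<integral>x. 2 / v * D2 x + u ^ 4 / 12 * (4 / m * D4 x + 6 / v * D2 x) + c * (A6 x / sqrt n) \<partial>sample n)"
    proof (rule integral_mono)
      show "integrable (sample n) (\<lambda>x. \<bar>cosh_weight n x u - exp (- (u ^ 4) / 12)\<bar>)"
        by (intro integrable_abs Bochner_Integration.integrable_diff cosh_weight_integrable) simp
      show "integrable (sample n) (\<lambda>x. 2 / v * D2 x + u ^ 4 / 12 * (4 / m * D4 x + 6 / v * D2 x) + c * (A6 x / sqrt n))"
        using D2 D4 A6 by (intro Bochner_Integration.integrable_add integrable_mult_right integrable_divide)
      show "\<bar>cosh_weight n x u - exp (- (u ^ 4) / 12)\<bar>
        \<le> 2 / v * D2 x + u ^ 4 / 12 * (4 / m * D4 x + 6 / v * D2 x) + c * (A6 x / sqrt n)" for x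
        using cosh_weight_approx[OF n, of x u] by (simp add: D2_def D4_def A6_def c_def)
    qed
    also have "\<dots> = 2 / v * (\<integral>x. D2 x \<partial>sample n)
        + u ^ 4 / 12 * (4 / m * (\<integral>x. D4 x \<partial>sample n) + 6 / v * (\<integral>x. D2 x \<partial>sample n)) + c * (m6 / sqrt n)"
      using D2(1) D4(1) A6 by simp
    also have "\<dots> \<le> bd n"
      unfolding bd_def using v_pos m_pos D2(2) D4(2)
      by (intro add_mono mult_left_mono order_refl) auto
    finally show ?thesis .
  qed
  then have le: "\<forall>\<^sub>F n in sequentially. norm (profile n u - exp (- (u ^ 4) / 12)) \<le> bd n"
    by (auto simp: eventually_at_top_linorder)
  have lim: "(\<lambda>n. sqrt (K / real n)) \<longlonglongrightarrow> 0" "(\<lambda>n. K / sqrt n) \<longlonglongrightarrow> 0" for K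
  proof -
    have "(\<lambda>n. sqrt (K / real n)) \<longlonglongrightarrow> sqrt 0"
      by (intro tendsto_real_sqrt lim_const_over_n)
    then show "(\<lambda>n. sqrt (K / real n)) \<longlonglongrightarrow> 0" by simp
    show "(\<lambda>n. K / sqrt n) \<longlonglongrightarrow> 0"
      by (intro real_tendsto_divide_at_top[OF tendsto_const] filterlim_compose[OF sqrt_at_top filterlim_real_sequentially])
  qed
  have "bd \<longlonglongrightarrow> 2 / v * 0 + u ^ 4 / 12 * (4 / m * 0 + 6 / v * 0) + c * 0"
    unfolding bd_def by (intro tendsto_intros lim)
  then have "bd \<longlonglongrightarrow> 0" by simp
  then have "(\<lambda>n. profile n u - exp (- (u ^ 4) / 12)) \<longlonglongrightarrow> 0"
    by (rule Lim_null_comparison[OF le])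
  then show ?thesis by (simp add: LIM_zero_iff)
qed

lemma profile_measurable [measurable]: "profile n \<in> borel_measurable borel"
proof -
  interpret P: prob_space "sample n" by (rule prob_space_iid)
  have [measurable]: "(\<lambda>z. cosh_weight n (snd z) (fst z)) \<in> borel_measurable (borel \<Otimes>\<^sub>M sample n)"
    using measurable_pair_swap[OF cosh_weight_measurable[of n]] by (simp add: case_prod_beta')
  show ?thesis unfolding profile_def[abs_def]
    by (rule P.borel_measurable_lebesgue_integral) (simp add: case_prod_beta')
qed

lemma profile_nonneg: "0 \<le> profile n u"
  by (simp add: profile_def cosh_weight_nonneg)

lemma profile_le_envelope: "n \<ge> 1 \<Longrightarrow> profile n u \<le> envelope u"
proof -
  assume n: "n \<ge> 1"
  interpret P: prob_space "sample n" by (rule prob_space_iid)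
  have "profile n u \<le> (\<integral>x. envelope u \<partial>sample n)"
    unfolding profile_def
    by (intro integral_mono cosh_weight_integrable cosh_weight_le_envelope n) simp
  then show ?thesis by (simp add: P.prob_space)
qed

lemma integral_profile_tendsto:
  fixes \<phi> :: "real \<Rightarrow> real"
  assumes [measurable]: "\<phi> \<in> borel_measurable borel" and \<phi>: "\<And>u. 0 \<le> \<phi> u" "\<And>u. \<phi> u \<le> 1"
  shows "(\<lambda>n. \<integral>u. \<phi> u * profile n u \<partial>lborel) \<longlonglongrightarrow> (\<integral>u. \<phi> u * exp (- (u ^ 4) / 12) \<partial>lborel)"
proof -
  have "(\<lambda>n. \<integral>u. \<phi> u * profile (Suc n) u \<partial>lborel) \<longlonglongrightarrow> (\<integral>u. \<phi> u * exp (- (u ^ 4) / 12) \<partial>lborel)"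
  proof (rule integral_dominated_convergence[where w = envelope])
    show "integrable lborel envelope" by (rule envelope_integrable_0)
    show "AE u in lborel. (\<lambda>n. \<phi> u * profile (Suc n) u) \<longlonglongrightarrow> \<phi> u * exp (- (u ^ 4) / 12)"
      by (intro AE_I2 tendsto_mult tendsto_const LIMSEQ_Suc[OF profile_tendsto])
    show "AE u in lborel. norm (\<phi> u * profile (Suc n) u) \<le> envelope u" for n
    proof (rule AE_I2)
      fix u
      have "\<phi> u * profile (Suc n) u \<le> 1 * envelope u"
        using \<phi> by (intro mult_mono profile_le_envelope profile_nonneg) auto
      then show "norm (\<phi> u * profile (Suc n) u) \<le> envelope u"
        using \<phi>(1)[of u] profile_nonneg[of "Suc n" u] by (simp add: abs_mult)
    qed
  qed measurable
  then show ?thesis by (rule LIMSEQ_imp_Suc)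
qed

section \<open>Comparison of the statistic with the mixing variable\<close>

definition statistic :: "nat \<Rightarrow> (nat \<Rightarrow> real) \<Rightarrow> real" where
  "statistic n x = m powr (1 / 4) * S n x / (v * n powr (3 / 4))"

lemma statistic_measurable [measurable]: "statistic n \<in> borel_measurable (sample n)"
  unfolding statistic_def[abs_def] by measurable

lemma statistic_eq_centre:
  assumes n: "n \<ge> 1" and T: "0 < T n x"
  shows "statistic n x = centre n x * sqrt (avg (\<lambda>y. y\<^sup>2) n x / v)"
proof -
  have n0: "0 < real n" using n by simp
  have avg: "avg (\<lambda>y. y\<^sup>2) n x = T n x / n" using n by (simp add: T_eq_avg)
  have sc: "scale n = n powr (1 / 4) * sqrt v / m powr (1 / 4)"
  proof -
    have "(v\<^sup>2) powr (1 / 4) = sqrt v"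
      using v_pos by (simp add: powr_half_sqrt[symmetric] powr_powr flip: powr_numeral)
    then show ?thesis
      using v_pos m_pos n0 by (simp add: scale_def powr_divide powr_mult)
  qed
  have n34: "n powr (3 / 4) = n powr (1 / 4) * sqrt n"
    using n0 by (simp add: powr_half_sqrt[symmetric] flip: powr_add)
  have "sqrt v * sqrt v = v" using v_pos by simp
  then show ?thesis
    unfolding statistic_def centre_def avg sc n34
    using T v_pos m_pos n0 by (simp add: real_sqrt_divide real_sqrt_mult field_simps)
qed

text \<open>
  The statistic is the conditional mean times \<open>\<surd>(\<tau> / v)\<close>, and \<open>|\<surd>a - 1| \<le> |a - 1|\<close>.
\<close>

lemma abs_statistic_centre_le:
  assumes n: "n \<ge> 1" and T: "0 < T n x"
  shows "\<bar>statistic n x - centre n x\<bar> \<le> \<bar>centre n x\<bar> * (\<bar>avg (\<lambda>y. y\<^sup>2) n x - v\<bar> / v)"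
proof -
  define a where "a = avg (\<lambda>y. y\<^sup>2) n x / v"
  have a: "0 \<le> a" using v_pos by (auto simp: a_def avg_def intro!: divide_nonneg_pos divide_nonneg_nonneg sum_nonneg)
  have "\<bar>sqrt a - 1\<bar> * 1 \<le> \<bar>sqrt a - 1\<bar> * (sqrt a + 1)"
    using a by (intro mult_left_mono) auto
  also have "\<dots> = \<bar>(sqrt a - 1) * (sqrt a + 1)\<bar>" using a by (simp add: abs_mult)
  also have "(sqrt a - 1) * (sqrt a + 1) = a - 1" using a by (simp add: algebra_simps)
  also have "\<bar>a - 1\<bar> = \<bar>avg (\<lambda>y. y\<^sup>2) n x - v\<bar> / v"
  proof -
    have "a - 1 = (avg (\<lambda>y. y\<^sup>2) n x - v) / v" using v_pos by (simp add: a_def diff_divide_distrib)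
    then show ?thesis using v_pos by simp
  qed
  finally have "\<bar>sqrt a - 1\<bar> \<le> \<bar>avg (\<lambda>y. y\<^sup>2) n x - v\<bar> / v" by simp
  moreover have "statistic n x - centre n x = centre n x * (sqrt a - 1)"
    using statistic_eq_centre[OF n T] by (simp add: a_def algebra_simps)
  ultimately show ?thesis by (simp only: abs_mult mult_left_mono abs_ge_zero)
qed

lemma tilde_mu_weight_le: "n \<ge> 1 \<Longrightarrow> tilde_mu_weight n x \<le> exp (n / 2)"
proof -
  assume n: "n \<ge> 1"
  have "(S n x)\<^sup>2 / T n x \<le> n" if "0 < T n x"
    using S_square_le[of n x] that by (simp add: pos_divide_le_eq)
  then show ?thesis
    by (cases "0 < T n x") (auto simp: tilde_mu_weight_def S_def T_def)
qed

lemma tilde_mu_weight_integrable: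
  assumes "n \<ge> 1" shows "integrable (sample n) (tilde_mu_weight n)"
proof -
  interpret P: prob_space "sample n" by (rule prob_space_iid)
  show ?thesis
    by (rule P.integrable_const_bound[where B = "exp (n / 2)"])
       (auto simp: tilde_mu_weight_nonneg tilde_mu_weight_le[OF assms])
qed

lemma mix_const_pos: "n \<ge> 1 \<Longrightarrow> 0 < mix_const n"
  using scale_pos by (simp add: mix_const_def)

text \<open>
  The test function is compared at the statistic and at the mixing variable. The distance between the
  two is at most \<open>|centre| * |\<tau> - v| / v\<close> plus the Gaussian fluctuation around the centre. The latter
  has mean absolute value \<open>\<surd>(2 / \<pi>) / scale\<close>. For the former, \<open>|centre|\<close> is at most the conditional mean
  of \<open>|u|\<close>; as \<open>\<tau>\<close> is insensitive to signs, the exchange formula applies to \<open>|u| * |\<tau> - v| / v\<close>, and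
  the envelope separates the integral over \<open>u\<close> from the law of large numbers.
\<close>

lemma mixture_comparison:
  fixes \<phi> :: "real \<Rightarrow> real"
  assumes n: "n \<ge> 1"
    and \<phi>[measurable]: "\<phi> \<in> borel_measurable borel" and bounds: "\<And>u. 0 \<le> \<phi> u" "\<And>u. \<phi> u \<le> 1"
    and lipschitz: "\<And>s t. \<bar>\<phi> s - \<phi> t\<bar> \<le> L * \<bar>s - t\<bar>" and L: "0 \<le> L"
  shows "\<bar>mix_const n * (\<integral>x. tilde_mu_weight n x * \<phi> (statistic n x) \<partial>sample n)
      - (\<integral>u. \<phi> u * profile n u \<partial>lborel)\<bar>
    \<le> L * ((\<integral>u. \<bar>u\<bar> * envelope u \<partial>lborel) * (\<integral>x. \<bar>avg (\<lambda>y. y\<^sup>2) n x - v\<bar> / v \<partial>sample n)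
        + sqrt (2 / pi) / scale n * (\<integral>u. profile n u \<partial>lborel))"
proof -
  interpret P: prob_space "sample n" by (rule prob_space_iid)
  define D where "D x = \<bar>avg (\<lambda>y. y\<^sup>2) n x - v\<bar> / v" for x
  define w where "w x = mix_const n * tilde_mu_weight n x" for x
  define s where "s = 1 / scale n"
  have s: "0 < s" using scale_pos[OF n] by (simp add: s_def)
  have w0: "0 \<le> w x" for x using mix_const_pos[OF n] by (simp add: w_def tilde_mu_weight_nonneg)
  have w_meas[measurable]: "w \<in> borel_measurable (sample n)" unfolding w_def[abs_def] by measurable
  have D0: "0 \<le> D x" for x using v_pos by (simp add: D_def)
  have D_int: "integrable (sample n) D"
  proof -
    have "integrable \<rho> (\<lambda>y. (y\<^sup>2)\<^sup>2)" using integrable_pow4 by simp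
    moreover have "(\<lambda>y. y\<^sup>2) \<in> borel_measurable \<rho>" by (simp add: measurable_cong_sets[OF sets_law refl])
    ultimately show ?thesis
      using weak_law_L1(1)[of "\<lambda>y. y\<^sup>2" n] n
      unfolding D_def[abs_def] avg_def variance_law_def by (intro integrable_divide) auto
  qed
  have D_meas[measurable]: "D \<in> borel_measurable (sample n)" using D_int by auto
  have D_flip: "D (flip j x) = D x" for j x
    using T_flip[of n j x] n by (simp add: D_def avg_def T_def)
  have N_int: "integrable lborel (\<lambda>u. g u * centred_normal n x u)"
    if [measurable]: "g \<in> borel_measurable borel" and g: "\<And>u. \<bar>g u\<bar> \<le> a + b * \<bar>u - centre n x\<bar>" for g a b x
  proof (rule Bochner_Integration.integrable_bound)
    show "integrable lborel (\<lambda>u. a * (normal_density (centre n x) s u * \<bar>u - centre n x\<bar> ^ 0)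
        + b * (normal_density (centre n x) s u * \<bar>u - centre n x\<bar> ^ 1))"
      by (intro Bochner_Integration.integrable_add integrable_mult_right integrable_normal_moment_abs s)
    show "AE u in lborel. norm (g u * centred_normal n x u) \<le> norm (a * (normal_density (centre n x) s u * \<bar>u - centre n x\<bar> ^ 0)
        + b * (normal_density (centre n x) s u * \<bar>u - centre n x\<bar> ^ 1))"
    proof (rule AE_I2)
      fix u
      have "\<bar>g u\<bar> * normal_density (centre n x) s u \<le> (a + b * \<bar>u - centre n x\<bar>) * normal_density (centre n x) s u"
        using s g by (intro mult_right_mono) auto
      also have "\<dots> \<le> \<bar>a * (normal_density (centre n x) s u * \<bar>u - centre n x\<bar> ^ 0)
        + b * (normal_density (centre n x) s u * \<bar>u - centre n x\<bar> ^ 1)\<bar>"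
        by (rule order_trans[OF _ abs_ge_self]) (simp add: algebra_simps)
      finally show "norm (g u * centred_normal n x u) \<le> norm (a * (normal_density (centre n x) s u * \<bar>u - centre n x\<bar> ^ 0)
        + b * (normal_density (centre n x) s u * \<bar>u - centre n x\<bar> ^ 1))"
        using s by (simp add: abs_mult s_def)
    qed
  qed measurable
  have N_1: "(\<integral>u. centred_normal n x u \<partial>lborel) = 1" for x
    using s by (simp add: s_def)
  have N_abs_int: "integrable lborel (\<lambda>u. \<bar>u\<bar> * centred_normal n x u)" for x
    by (rule N_int[of _ "\<bar>centre n x\<bar>" 1 x]) auto
  have N_mean: "\<bar>centre n x\<bar> \<le> (\<integral>u. \<bar>u\<bar> * centred_normal n x u \<partial>lborel)" for x
  proof -
    have "centre n x = (\<integral>u. u * centred_normal n x u \<partial>lborel)"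
      using integral_normal_moment_nz_1[OF s, of "centre n x"] by (simp add: s_def mult.commute)
    also have "\<bar>\<dots>\<bar> \<le> (\<integral>u. \<bar>u * centred_normal n x u\<bar> \<partial>lborel)" by (rule integral_abs_bound)
    also have "\<dots> = (\<integral>u. \<bar>u\<bar> * centred_normal n x u \<partial>lborel)"
      using s by (simp add: abs_mult s_def)
    finally show ?thesis .
  qed
  have N_dev: "(\<integral>u. \<bar>u - centre n x\<bar> * centred_normal n x u \<partial>lborel) = sqrt (2 / pi) / scale n" for x
    using integral_normal_moment_abs_odd[OF s, of "centre n x" 0] by (simp add: s_def mult.commute)
  have \<phi>_mix:
    "integrable (sample n) (\<lambda>x. w x * (\<integral>u. \<phi> u * centred_normal n x u \<partial>lborel))"
    "(\<integral>x. w x * (\<integral>u. \<phi> u * centred_normal n x u \<partial>lborel) \<partial>sample n) = (\<integral>u. \<phi> u * profile n u \<partial>lborel)"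
  proof -
    have "(\<lambda>(x, u). \<phi> u) \<in> borel_measurable (sample n \<Otimes>\<^sub>M lborel)" by measurable
    moreover have "\<phi> u \<le> 1 * (1 + \<bar>u\<bar>)" for u using bounds(2)[of u] by simp
    ultimately show "integrable (sample n) (\<lambda>x. w x * (\<integral>u. \<phi> u * centred_normal n x u \<partial>lborel))"
      "(\<integral>x. w x * (\<integral>u. \<phi> u * centred_normal n x u \<partial>lborel) \<partial>sample n) = (\<integral>u. \<phi> u * profile n u \<partial>lborel)"
      using mixture_integrable[OF n, of "\<lambda>_. \<phi>" "\<lambda>_. 1"] mixture_integral[OF n, of "\<lambda>_. \<phi>" "\<lambda>_. 1"] bounds
      by (simp_all add: w_def profile_def)
  qed
  have one_mix: "(\<integral>x. w x \<partial>sample n) = (\<integral>u. profile n u \<partial>lborel)"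
  proof -
    have m: "(\<lambda>(x, u). 1 :: real) \<in> borel_measurable (sample n \<Otimes>\<^sub>M lborel)" by simp
    have i: "integrable (sample n) (\<lambda>_. 1 :: real)" by simp
    have b: "(1 :: real) \<le> 1 * (1 + \<bar>u\<bar>)" for u :: real by simp
    have "(\<integral>x. w x * (\<integral>u. 1 * centred_normal n x u \<partial>lborel) \<partial>sample n)
        = (\<integral>u. (\<integral>x. 1 * cosh_weight n x u \<partial>sample n) \<partial>lborel)"
      unfolding w_def by (rule mixture_integral[OF n m zero_le_one refl i b])
    then show ?thesis by (simp only: mult_1_left mult_1_right N_1 profile_def)
  qed
  have D_mix:
    "integrable (sample n) (\<lambda>x. w x * (D x * (\<integral>u. \<bar>u\<bar> * centred_normal n x u \<partial>lborel)))"
    "(\<integral>x. w x * (D x * (\<integral>u. \<bar>u\<bar> * centred_normal n x u \<partial>lborel)) \<partial>sample n)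
      \<le> (\<integral>u. \<bar>u\<bar> * envelope u \<partial>lborel) * (\<integral>x. D x \<partial>sample n)"
  proof -
    have inner: "w x * (\<integral>u. D x * \<bar>u\<bar> * centred_normal n x u \<partial>lborel)
        = w x * (D x * (\<integral>u. \<bar>u\<bar> * centred_normal n x u \<partial>lborel))" for x
      by (subst integral_mult_right_zero[symmetric]) (simp add: mult.assoc)
    have m: "(\<lambda>(x, u). D x * \<bar>u\<bar>) \<in> borel_measurable (sample n \<Otimes>\<^sub>M lborel)" by measurable
    have b: "D x * \<bar>u\<bar> \<le> D x * (1 + \<bar>u\<bar>)" for x u using D0[of x] by (intro mult_left_mono) auto
    have nn: "0 \<le> D x * \<bar>u\<bar>" for x u using D0[of x] by simp
    have ev: "D (flip j x) * \<bar>u\<bar> = D x * \<bar>u\<bar>" for j x u by (simp add: D_flip)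
    note mix = mixture_integrable[OF n m nn ev D_int b] mixture_integral[OF n m nn ev D_int b]
      mixture_integrable_cosh[OF n m nn ev D_int b]
    show "integrable (sample n) (\<lambda>x. w x * (D x * (\<integral>u. \<bar>u\<bar> * centred_normal n x u \<partial>lborel)))"
      using mix(1) by (simp only: w_def[symmetric] inner)
    interpret pair_sigma_finite "sample n" lborel by (rule pair_sigma_finite_sample)
    have "(\<integral>x. w x * (D x * (\<integral>u. \<bar>u\<bar> * centred_normal n x u \<partial>lborel)) \<partial>sample n)
        = (\<integral>u. (\<integral>x. D x * \<bar>u\<bar> * cosh_weight n x u \<partial>sample n) \<partial>lborel)"
      using mix(2) by (simp only: w_def[symmetric] inner)
    also have "\<dots> \<le> (\<integral>u. \<bar>u\<bar> * envelope u * (\<integral>x. D x \<partial>sample n) \<partial>lborel)"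
    proof (rule integral_mono)
      show "integrable lborel (\<lambda>u. \<integral>x. D x * \<bar>u\<bar> * cosh_weight n x u \<partial>sample n)"
        by (rule integrable_snd[OF mix(3)])
      show "integrable lborel (\<lambda>u. \<bar>u\<bar> * envelope u * (\<integral>x. D x \<partial>sample n))"
        by (intro integrable_mult_left envelope_integrable_1)
      fix u
      have "(\<integral>x. D x * \<bar>u\<bar> * cosh_weight n x u \<partial>sample n) \<le> (\<integral>x. \<bar>u\<bar> * envelope u * D x \<partial>sample n)"
      proof (rule integral_mono')
        show "integrable (sample n) (\<lambda>x. \<bar>u\<bar> * envelope u * D x)"
          by (intro integrable_mult_right D_int)
        show "D x * \<bar>u\<bar> * cosh_weight n x u \<le> \<bar>u\<bar> * envelope u * D x" for x
          using mult_left_mono[OF cosh_weight_le_envelope[OF n, of x u] nn[of x u]] by (simp add: mult_ac)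
        show "0 \<le> \<bar>u\<bar> * envelope u * D x" for x
          using D0[of x] envelope_nonneg[of u] by simp
      qed
      then show "(\<integral>x. D x * \<bar>u\<bar> * cosh_weight n x u \<partial>sample n) \<le> \<bar>u\<bar> * envelope u * (\<integral>x. D x \<partial>sample n)"
        by simp
    qed
    also have "\<dots> = (\<integral>u. \<bar>u\<bar> * envelope u \<partial>lborel) * (\<integral>x. D x \<partial>sample n)" by simp
    finally show "(\<integral>x. w x * (D x * (\<integral>u. \<bar>u\<bar> * centred_normal n x u \<partial>lborel)) \<partial>sample n)
      \<le> (\<integral>u. \<bar>u\<bar> * envelope u \<partial>lborel) * (\<integral>x. D x \<partial>sample n)" .
  qed
  have w_int: "integrable (sample n) w"
    unfolding w_def[abs_def] by (intro integrable_mult_right tilde_mu_weight_integrable n)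
  have \<phi>_int: "integrable (sample n) (\<lambda>x. w x * \<phi> (statistic n x))"
    using w_int
    by (rule Bochner_Integration.integrable_bound)
       (use w0 bounds in \<open>auto simp: abs_mult intro!: mult_left_le\<close>)
  have pointwise: "\<bar>w x * \<phi> (statistic n x) - w x * (\<integral>u. \<phi> u * centred_normal n x u \<partial>lborel)\<bar>
      \<le> L * (w x * (D x * (\<integral>u. \<bar>u\<bar> * centred_normal n x u \<partial>lborel)) + sqrt (2 / pi) / scale n * w x)" for x
  proof (cases "0 < T n x")
    case False
    then have "w x = 0" by (simp add: w_def tilde_mu_weight_def T_def)
    then show ?thesis by simp
  next
    case True
    let ?y = "statistic n x" and ?c = "centre n x"
    have int\<phi>: "integrable lborel (\<lambda>u. \<phi> u * centred_normal n x u)"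
      by (rule N_int[of _ 1 0 x]) (use bounds in auto)
    have intc: "integrable lborel (\<lambda>u. \<phi> ?y * centred_normal n x u)"
      by (rule N_int[of _ 1 0 x]) (use bounds in auto)
    have intd: "integrable lborel (\<lambda>u. \<bar>u - ?c\<bar> * centred_normal n x u)"
      by (rule N_int[of _ 0 1 x]) auto
    have int1: "integrable lborel (\<lambda>u. \<bar>?y - ?c\<bar> * centred_normal n x u)"
      by (rule N_int[of _ "\<bar>?y - ?c\<bar>" 0 x]) auto
    have "\<phi> ?y - (\<integral>u. \<phi> u * centred_normal n x u \<partial>lborel)
        = (\<integral>u. \<phi> ?y * centred_normal n x u - \<phi> u * centred_normal n x u \<partial>lborel)"
      using int\<phi> intc by (simp add: N_1)
    then have "\<bar>\<phi> ?y - (\<integral>u. \<phi> u * centred_normal n x u \<partial>lborel)\<bar>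
        = \<bar>\<integral>u. \<phi> ?y * centred_normal n x u - \<phi> u * centred_normal n x u \<partial>lborel\<bar>"
      by (rule arg_cong)
    also have "\<dots> \<le> (\<integral>u. \<bar>\<phi> ?y * centred_normal n x u - \<phi> u * centred_normal n x u\<bar> \<partial>lborel)"
      by (rule integral_abs_bound)
    also have "\<dots> \<le> (\<integral>u. L * (\<bar>?y - ?c\<bar> * centred_normal n x u + \<bar>u - ?c\<bar> * centred_normal n x u) \<partial>lborel)"
    proof (rule integral_mono)
      show "integrable lborel (\<lambda>u. \<bar>\<phi> ?y * centred_normal n x u - \<phi> u * centred_normal n x u\<bar>)"
        by (rule integrable_abs[OF Bochner_Integration.integrable_diff[OF intc int\<phi>]])
      show "integrable lborel (\<lambda>u. L * (\<bar>?y - ?c\<bar> * centred_normal n x u + \<bar>u - ?c\<bar> * centred_normal n x u))"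
        by (intro integrable_mult_right Bochner_Integration.integrable_add int1 intd)
      fix u
      have "\<bar>\<phi> ?y - \<phi> u\<bar> \<le> L * (\<bar>?y - ?c\<bar> + \<bar>u - ?c\<bar>)"
      proof (rule order_trans[OF lipschitz])
        show "L * \<bar>?y - u\<bar> \<le> L * (\<bar>?y - ?c\<bar> + \<bar>u - ?c\<bar>)"
          using L by (intro mult_left_mono) auto
      qed
      then have "\<bar>\<phi> ?y - \<phi> u\<bar> * centred_normal n x u \<le> L * (\<bar>?y - ?c\<bar> + \<bar>u - ?c\<bar>) * centred_normal n x u"
        using s by (intro mult_right_mono) auto
      moreover have "\<bar>\<phi> ?y * centred_normal n x u - \<phi> u * centred_normal n x u\<bar> = \<bar>\<phi> ?y - \<phi> u\<bar> * centred_normal n x u"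
        by (simp add: abs_mult flip: left_diff_distrib)
      ultimately show "\<bar>\<phi> ?y * centred_normal n x u - \<phi> u * centred_normal n x u\<bar>
          \<le> L * (\<bar>?y - ?c\<bar> * centred_normal n x u + \<bar>u - ?c\<bar> * centred_normal n x u)"
        by (simp add: algebra_simps)
    qed
    also have "\<dots> = L * (\<bar>?y - ?c\<bar> + sqrt (2 / pi) / scale n)"
      using int1 intd by (simp add: N_1 N_dev)
    also have "\<dots> \<le> L * (D x * (\<integral>u. \<bar>u\<bar> * centred_normal n x u \<partial>lborel) + sqrt (2 / pi) / scale n)"
    proof (intro mult_left_mono add_right_mono L)
      have "\<bar>?y - ?c\<bar> \<le> \<bar>?c\<bar> * D x" using abs_statistic_centre_le[OF n True] by (simp add: D_def)
      also have "\<dots> \<le> (\<integral>u. \<bar>u\<bar> * centred_normal n x u \<partial>lborel) * D x"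
        by (intro mult_right_mono N_mean D0)
      finally show "\<bar>?y - ?c\<bar> \<le> D x * (\<integral>u. \<bar>u\<bar> * centred_normal n x u \<partial>lborel)" by (simp add: mult.commute)
    qed
    finally have "w x * \<bar>\<phi> ?y - (\<integral>u. \<phi> u * centred_normal n x u \<partial>lborel)\<bar>
        \<le> w x * (L * (D x * (\<integral>u. \<bar>u\<bar> * centred_normal n x u \<partial>lborel) + sqrt (2 / pi) / scale n))"
      by (rule mult_left_mono) (rule w0)
    moreover have "\<bar>w x * \<phi> ?y - w x * (\<integral>u. \<phi> u * centred_normal n x u \<partial>lborel)\<bar>
        = w x * \<bar>\<phi> ?y - (\<integral>u. \<phi> u * centred_normal n x u \<partial>lborel)\<bar>"
      using w0[of x] by (simp add: abs_mult flip: right_diff_distrib)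
    ultimately show ?thesis by (simp add: distrib_left mult_ac)
  qed
  have "mix_const n * (\<integral>x. tilde_mu_weight n x * \<phi> (statistic n x) \<partial>sample n) - (\<integral>u. \<phi> u * profile n u \<partial>lborel)
      = (\<integral>x. w x * \<phi> (statistic n x) - w x * (\<integral>u. \<phi> u * centred_normal n x u \<partial>lborel) \<partial>sample n)"
    using \<phi>_int \<phi>_mix by (simp add: w_def mult.assoc)
  then have "\<bar>mix_const n * (\<integral>x. tilde_mu_weight n x * \<phi> (statistic n x) \<partial>sample n) - (\<integral>u. \<phi> u * profile n u \<partial>lborel)\<bar>
      = \<bar>\<integral>x. w x * \<phi> (statistic n x) - w x * (\<integral>u. \<phi> u * centred_normal n x u \<partial>lborel) \<partial>sample n\<bar>"
    by (rule arg_cong)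
  also have "\<dots> \<le> (\<integral>x. \<bar>w x * \<phi> (statistic n x) - w x * (\<integral>u. \<phi> u * centred_normal n x u \<partial>lborel)\<bar> \<partial>sample n)"
    by (rule integral_abs_bound)
  also have "\<dots> \<le> (\<integral>x. L * (w x * (D x * (\<integral>u. \<bar>u\<bar> * centred_normal n x u \<partial>lborel)) + sqrt (2 / pi) / scale n * w x) \<partial>sample n)"
    by (intro integral_mono pointwise integrable_abs Bochner_Integration.integrable_diff
        Bochner_Integration.integrable_add integrable_mult_right \<phi>_int \<phi>_mix(1) D_mix(1) w_int)
  also have "\<dots> = L * ((\<integral>x. w x * (D x * (\<integral>u. \<bar>u\<bar> * centred_normal n x u \<partial>lborel)) \<partial>sample n)
      + sqrt (2 / pi) / scale n * (\<integral>u. profile n u \<partial>lborel))"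
    using D_mix(1) w_int by (simp add: one_mix)
  also have "\<dots> \<le> L * ((\<integral>u. \<bar>u\<bar> * envelope u \<partial>lborel) * (\<integral>x. D x \<partial>sample n)
      + sqrt (2 / pi) / scale n * (\<integral>u. profile n u \<partial>lborel))"
    by (intro mult_left_mono add_right_mono D_mix(2) L)
  finally show ?thesis by (simp add: D_def)
qed

lemma scale_at_top: "filterlim scale at_top sequentially"
proof -
  have "filterlim (\<lambda>n. sqrt (v / sqrt m * sqrt (real n))) at_top sequentially"
    using v_pos m_pos
    by (intro filterlim_compose[OF sqrt_at_top] filterlim_tendsto_pos_mult_at_top[OF tendsto_const]
        filterlim_compose[OF sqrt_at_top filterlim_real_sequentially]) auto
  moreover have "scale n = sqrt (v / sqrt m * sqrt (real n))" if "n \<ge> 1" for n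
    using scale_pos[OF that] scale_pow2[OF that]
    by (intro real_sqrt_unique[symmetric]) (simp_all add: mult.commute)
  then have "\<forall>\<^sub>F n in sequentially. sqrt (v / sqrt m * sqrt (real n)) = scale n"
    by (intro eventually_sequentiallyI[of 1]) simp
  ultimately show ?thesis by (rule filterlim_cong[THEN iffD1, OF refl refl, rotated])
qed

lemma mixture_expectation_tendsto:
  fixes \<phi> :: "real \<Rightarrow> real"
  assumes \<phi>: "\<phi> \<in> borel_measurable borel" "\<And>u. 0 \<le> \<phi> u" "\<And>u. \<phi> u \<le> 1"
    and lipschitz: "\<And>s t. \<bar>\<phi> s - \<phi> t\<bar> \<le> L * \<bar>s - t\<bar>" and L: "0 \<le> L"
  shows "(\<lambda>n. mix_const n * (\<integral>x. tilde_mu_weight n x * \<phi> (statistic n x) \<partial>sample n))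
    \<longlonglongrightarrow> (\<integral>u. \<phi> u * exp (- (u ^ 4) / 12) \<partial>lborel)"
proof -
  let ?a = "\<lambda>n. mix_const n * (\<integral>x. tilde_mu_weight n x * \<phi> (statistic n x) \<partial>sample n)"
  define K where "K = (\<integral>u. \<bar>u\<bar> * envelope u \<partial>lborel)"
  define V2 where "V2 = variance (\<lambda>y. y\<^sup>2)"
  define bd where "bd n = L * (K * (sqrt (V2 / n) / v) + sqrt (2 / pi) / scale n * (\<integral>u. profile n u \<partial>lborel))" for n :: nat
  have K: "0 \<le> K" unfolding K_def by (intro integral_nonneg_AE) (auto simp: envelope_nonneg)
  have le: "\<forall>\<^sub>F n in sequentially. norm (?a n - (\<integral>u. \<phi> u * profile n u \<partial>lborel)) \<le> bd n"
  proof (rule eventually_sequentiallyI[of 1])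
    fix n :: nat assume n: "1 \<le> n"
    have q: "(\<lambda>y. y\<^sup>2) \<in> borel_measurable \<rho>" "integrable \<rho> (\<lambda>y. (y\<^sup>2)\<^sup>2)"
      using integrable_pow4 by (simp_all add: measurable_cong_sets[OF sets_law refl])
    have "(\<integral>x. \<bar>avg (\<lambda>y. y\<^sup>2) n x - v\<bar> \<partial>sample n) \<le> sqrt (V2 / n)"
      using weak_law_L1(2)[OF q n] by (simp add: avg_def variance_law_def V2_def)
    then have "(\<integral>x. \<bar>avg (\<lambda>y. y\<^sup>2) n x - v\<bar> / v \<partial>sample n) \<le> sqrt (V2 / n) / v"
      using v_pos by (simp add: divide_right_mono)
    then have "L * (K * (\<integral>x. \<bar>avg (\<lambda>y. y\<^sup>2) n x - v\<bar> / v \<partial>sample n)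
        + sqrt (2 / pi) / scale n * (\<integral>u. profile n u \<partial>lborel)) \<le> bd n"
      unfolding bd_def by (intro mult_left_mono add_right_mono K L)
    with mixture_comparison[OF n \<phi> lipschitz L]
    show "norm (?a n - (\<integral>u. \<phi> u * profile n u \<partial>lborel)) \<le> bd n" by (simp add: K_def)
  qed
  have "(\<lambda>n. \<integral>u. 1 * profile n u \<partial>lborel) \<longlonglongrightarrow> (\<integral>u. 1 * exp (- (u ^ 4) / 12) \<partial>lborel)"
    by (rule integral_profile_tendsto) auto
  then have one: "(\<lambda>n. \<integral>u. profile n u \<partial>lborel) \<longlonglongrightarrow> (\<integral>u. exp (- (u ^ 4) / 12) \<partial>lborel)" by simp
  have "(\<lambda>n. sqrt (V2 / real n)) \<longlonglongrightarrow> sqrt 0"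
    by (intro tendsto_real_sqrt lim_const_over_n)
  moreover have "(\<lambda>n. sqrt (2 / pi) / scale n) \<longlonglongrightarrow> 0"
    by (rule real_tendsto_divide_at_top[OF tendsto_const scale_at_top])
  ultimately have "bd \<longlonglongrightarrow> L * (K * (sqrt 0 / v) + 0 * (\<integral>u. exp (- (u ^ 4) / 12) \<partial>lborel))"
    unfolding bd_def using v_pos by (intro tendsto_intros one) auto
  then have "bd \<longlonglongrightarrow> 0" by simp
  then have "(\<lambda>n. ?a n - (\<integral>u. \<phi> u * profile n u \<partial>lborel)) \<longlonglongrightarrow> 0"
    by (rule Lim_null_comparison[OF le])
  from tendsto_add[OF this integral_profile_tendsto[OF \<phi>]] show ?thesis by simp
qed

section \<open>Convergence in distribution\<close>

lemma expectation_tilde_mu: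
  fixes \<phi> :: "real \<Rightarrow> real"
  assumes [measurable]: "\<phi> \<in> borel_measurable borel"
  shows "(\<integral>x. \<phi> (statistic n x) \<partial>tilde_mu n \<rho>)
    = (\<integral>x. tilde_mu_weight n x * \<phi> (statistic n x) \<partial>sample n) / tilde_mu_Z n \<rho>"
proof -
  have Z: "0 \<le> tilde_mu_Z n \<rho>"
    unfolding tilde_mu_Z_def by (intro integral_nonneg_AE) (simp add: tilde_mu_weight_nonneg)
  have "(\<integral>x. \<phi> (statistic n x) \<partial>tilde_mu n \<rho>)
      = (\<integral>x. (1 / tilde_mu_Z n \<rho> * tilde_mu_weight n x) *\<^sub>R \<phi> (statistic n x) \<partial>sample n)"
    unfolding tilde_mu_def
    by (rule integral_density) (auto simp: tilde_mu_weight_nonneg Z)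
  also have "\<dots> = (\<integral>x. (tilde_mu_weight n x * \<phi> (statistic n x)) / tilde_mu_Z n \<rho> \<partial>sample n)"
    by (simp add: mult_ac)
  also have "\<dots> = (\<integral>x. tilde_mu_weight n x * \<phi> (statistic n x) \<partial>sample n) / tilde_mu_Z n \<rho>"
    by (rule integral_divide_zero)
  finally show ?thesis .
qed

text \<open>
  The constant \<open>mix_const\<close> cancels between the integral of the test function and the normalising
  constant, which is the case of a constant test function.
\<close>

lemma expectation_tilde_mu_tendsto:
  fixes \<phi> :: "real \<Rightarrow> real"
  assumes \<phi>: "\<phi> \<in> borel_measurable borel" "\<And>u. 0 \<le> \<phi> u" "\<And>u. \<phi> u \<le> 1"
    and lipschitz: "\<And>s t. \<bar>\<phi> s - \<phi> t\<bar> \<le> L * \<bar>s - t\<bar>" and L: "0 \<le> L"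
  shows "(\<lambda>n. \<integral>x. \<phi> (statistic n x) \<partial>tilde_mu n \<rho>)
    \<longlonglongrightarrow> (\<integral>u. \<phi> u * exp (- (u ^ 4) / 12) \<partial>lborel) / quartic_mass"
proof -
  let ?a = "\<lambda>n. mix_const n * (\<integral>x. tilde_mu_weight n x * \<phi> (statistic n x) \<partial>sample n)"
  have "(\<lambda>n. mix_const n * (\<integral>x. tilde_mu_weight n x * (\<lambda>_. 1) (statistic n x) \<partial>sample n))
      \<longlonglongrightarrow> (\<integral>u. (\<lambda>_. 1) u * exp (- (u ^ 4) / 12) \<partial>lborel)"
    by (rule mixture_expectation_tendsto[where L = 0]) auto
  then have Z: "(\<lambda>n. mix_const n * tilde_mu_Z n \<rho>) \<longlonglongrightarrow> quartic_mass"
    by (simp add: tilde_mu_Z_def quartic_mass_def)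
  have "(\<lambda>n. ?a n / (mix_const n * tilde_mu_Z n \<rho>))
      \<longlonglongrightarrow> (\<integral>u. \<phi> u * exp (- (u ^ 4) / 12) \<partial>lborel) / quartic_mass"
    using quartic_mass_pos
    by (intro tendsto_divide mixture_expectation_tendsto[OF \<phi> lipschitz L] Z) auto
  moreover have "\<forall>\<^sub>F n in sequentially.
      ?a n / (mix_const n * tilde_mu_Z n \<rho>) = (\<integral>x. \<phi> (statistic n x) \<partial>tilde_mu n \<rho>)"
    using eventually_ge_at_top[of 1]
  proof eventually_elim
    case (elim n)
    then show ?case using mix_const_pos[of n] by (simp add: expectation_tilde_mu[OF \<phi>(1)])
  qed
  ultimately show ?thesis by (rule Lim_transform_eventually)
qed

end

text \<open>
  The piecewise linear steps that determine weak convergence are Lipschitz test functions.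
\<close>

lemma cts_step_properties:
  assumes "a < b"
  shows "0 \<le> cts_step a b s" and "cts_step a b s \<le> 1"
    and "\<bar>cts_step a b s - cts_step a b t\<bar> \<le> 1 / (b - a) * \<bar>s - t\<bar>"
proof -
  have eq: "cts_step a b x = max 0 (min 1 ((b - x) / (b - a)))" for x
    using assms by (auto simp: cts_step_def max_def min_def field_simps)
  show "0 \<le> cts_step a b s" "cts_step a b s \<le> 1" by (simp_all add: eq)
  have "\<bar>max 0 (min 1 p) - max 0 (min 1 q)\<bar> \<le> \<bar>p - q\<bar>" for p q :: real by linarith
  then have "\<bar>cts_step a b s - cts_step a b t\<bar> \<le> \<bar>(b - s) / (b - a) - (b - t) / (b - a)\<bar>"
    unfolding eq .
  also have "(b - s) / (b - a) - (b - t) / (b - a) = 1 / (b - a) * (t - s)"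
    by (simp add: diff_divide_distrib)
  also have "\<bar>\<dots>\<bar> = 1 / (b - a) * \<bar>s - t\<bar>" using assms by (simp add: abs_mult abs_minus_commute)
  finally show "\<bar>cts_step a b s - cts_step a b t\<bar> \<le> 1 / (b - a) * \<bar>s - t\<bar>" .
qed

context symmetric_law
begin

text \<open>
  The limit theorem for an arbitrary symmetric law with the moments required by the locale. The case
  \<open>n = 0\<close>, in which the law of the sample is unspecified, is removed by shifting the sequence.
\<close>

theorem self_normalised_limit:
  fixes M :: "nat \<Rightarrow> 'b measure" and X :: "nat \<Rightarrow> nat \<Rightarrow> 'b \<Rightarrow> real"
  assumes prob: "\<And>n. n \<ge> 1 \<Longrightarrow> prob_space (M n)"
    and X: "\<And>n i. i < n \<Longrightarrow> X n i \<in> borel_measurable (M n)"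
    and law: "\<And>n. n \<ge> 1 \<Longrightarrow>
           distr (M n) (\<Pi>\<^sub>M i\<in>{..<n}. borel) (\<lambda>\<omega>. \<lambda>i\<in>{..<n}. X n i \<omega>) = tilde_mu n \<rho>"
  shows "weak_conv_m
    (\<lambda>n. distr (M n) borel (\<lambda>\<omega>. m powr (1 / 4) * (\<Sum>i<n. X n i \<omega>) / (v * real n powr (3 / 4))))
    quartic_law"
proof -
  let ?Y = "\<lambda>n \<omega>. m powr (1 / 4) * (\<Sum>i<n. X n i \<omega>) / (v * real n powr (3 / 4))"
  let ?V = "\<lambda>n \<omega>. \<lambda>i\<in>{..<n}. X n i \<omega>"
  have Y_meas: "?Y n \<in> borel_measurable (M n)" for n
    using X by (intro borel_measurable_divide borel_measurable_times borel_measurable_sum) auto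
  have V_meas: "?V n \<in> measurable (M n) (\<Pi>\<^sub>M i\<in>{..<n}. borel)" for n
    using X by (intro measurable_restrict) auto
  have Y_V: "?Y n \<omega> = statistic n (?V n \<omega>)" for n \<omega>
    by (simp add: statistic_def S_def)
  have stat: "statistic n \<in> borel_measurable (\<Pi>\<^sub>M i\<in>{..<n}. borel)" for n
    using statistic_measurable[of n] measurable_cong_sets[OF sets_PiM_cong[OF refl sets_law] refl] by blast
  have expectation: "(\<integral>y. \<phi> y \<partial>distr (M n) borel (?Y n)) = (\<integral>x. \<phi> (statistic n x) \<partial>tilde_mu n \<rho>)"
    if [measurable]: "\<phi> \<in> borel_measurable borel" and n: "n \<ge> 1" for \<phi> :: "real \<Rightarrow> real" and n
  proof -
    have "(\<integral>y. \<phi> y \<partial>distr (M n) borel (?Y n)) = (\<integral>\<omega>. \<phi> (statistic n (?V n \<omega>)) \<partial>M n)"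
      unfolding Y_V[symmetric] by (rule integral_distr[OF Y_meas]) simp
    also have "\<dots> = (\<integral>x. \<phi> (statistic n x) \<partial>distr (M n) (\<Pi>\<^sub>M i\<in>{..<n}. borel) (?V n))"
      by (rule integral_distr[symmetric, OF V_meas]) (rule measurable_compose[OF stat that(1)])
    finally show ?thesis by (simp only: law[OF n])
  qed
  have "weak_conv_m (\<lambda>n. distr (M (Suc n)) borel (?Y (Suc n))) quartic_law"
  proof (rule integral_cts_step_conv_imp_weak_conv)
    show "real_distribution (distr (M (Suc n)) borel (?Y (Suc n)))" for n
      by (intro prob_space.real_distribution_distr prob Y_meas) simp
    show "real_distribution quartic_law" by (rule real_distribution_quartic_law)
    fix a b :: real assume ab: "a < b"
    have meas: "cts_step a b \<in> borel_measurable borel"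
      by (intro borel_measurable_continuous_onI uniformly_continuous_imp_continuous cts_step_uniformly_continuous ab)
    have "(\<lambda>n. \<integral>x. cts_step a b (statistic n x) \<partial>tilde_mu n \<rho>) \<longlonglongrightarrow> integral\<^sup>L quartic_law (cts_step a b)"
      unfolding integral_quartic_law[OF meas]
      using cts_step_properties[OF ab] ab
      by (intro expectation_tilde_mu_tendsto[where L = "1 / (b - a)"] meas) auto
    then show "(\<lambda>n. integral\<^sup>L (distr (M (Suc n)) borel (?Y (Suc n))) (cts_step a b))
        \<longlonglongrightarrow> integral\<^sup>L quartic_law (cts_step a b)"
      by (subst expectation[OF meas]) (auto intro: LIMSEQ_Suc)
  qed
  then show ?thesis
    unfolding weak_conv_m_def weak_conv_def by (auto intro: LIMSEQ_imp_Suc)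
qed

end

text \<open>
  Evenness of the density gives symmetry, a Gaussian exponential moment dominates the eighth power,
  and a law with a density cannot be concentrated at 0.
\<close>

lemma symmetric_lawI:
  fixes f :: "real \<Rightarrow> real"
  assumes prob: "prob_space \<rho>"
    and f[measurable]: "f \<in> borel_measurable borel" and f0: "\<And>x. f x \<ge> 0"
    and \<rho>: "\<rho> = density lborel (\<lambda>x. ennreal (f x))"
    and even: "\<And>x. f (- x) = f x"
    and c: "c > 0" and exp_moment: "(\<integral>\<^sup>+z. ennreal (exp (c * z\<^sup>2) * f z) \<partial>lborel) < \<infinity>"
  shows "symmetric_law \<rho>"
proof -
  interpret prob_space \<rho> by fact
  have sets: "sets \<rho> = sets borel" by (simp add: \<rho>)
  have meas_pow: "(\<lambda>x. x ^ k) \<in> borel_measurable \<rho>" for k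
    by (simp add: measurable_cong_sets[OF sets refl])
  have "distr \<rho> borel uminus = density (distr lborel borel uminus) (\<lambda>x. ennreal (f x))"
    unfolding \<rho> by (subst density_distr) (auto simp: even)
  then have symmetric: "distr \<rho> borel uminus = \<rho>"
    by (simp add: lborel_distr_uminus \<rho>)
  have moment8: "integrable \<rho> (\<lambda>x. x ^ 8)"
  proof (rule Bochner_Integration.integrable_bound)
    have "(\<integral>\<^sup>+z. ennreal (exp (c * z\<^sup>2)) \<partial>\<rho>) = (\<integral>\<^sup>+z. ennreal (exp (c * z\<^sup>2) * f z) \<partial>lborel)"
      unfolding \<rho> by (subst nn_integral_density) (auto simp: f0 ennreal_mult mult.commute)
    then have "integrable \<rho> (\<lambda>z. exp (c * z\<^sup>2))"
      using exp_moment by (intro integrableI_nonneg) (auto simp: measurable_cong_sets[OF sets refl])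
    then show "integrable \<rho> (\<lambda>z. 256 / c ^ 4 * exp (c * z\<^sup>2))" by simp
    show "AE x in \<rho>. norm (x ^ 8) \<le> norm (256 / c ^ 4 * exp (c * x\<^sup>2))"
    proof (rule AE_I2)
      fix x :: real
      have "c * x\<^sup>2 / 4 \<le> exp (c * x\<^sup>2 / 4)"
        using exp_ge_add_one_self[of "c * x\<^sup>2 / 4"] by linarith
      then have "(c * x\<^sup>2 / 4) ^ 4 \<le> exp (c * x\<^sup>2 / 4) ^ 4"
        using c by (intro power_mono) auto
      also have "\<dots> = exp (c * x\<^sup>2)" by (simp flip: exp_of_nat_mult)
      finally have "c ^ 4 * x ^ 8 / 256 \<le> exp (c * x\<^sup>2)"
        by (simp add: power_mult_distrib power_divide flip: power_mult)
      then show "norm (x ^ 8) \<le> norm (256 / c ^ 4 * exp (c * x\<^sup>2))"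
        using c by (simp add: field_simps abs_mult)
    qed
  qed (rule meas_pow)
  have "0 < expectation (\<lambda>x. x\<^sup>2)"
  proof (rule ccontr)
    assume "\<not> 0 < expectation (\<lambda>x. x\<^sup>2)"
    moreover have "0 \<le> expectation (\<lambda>x. x\<^sup>2)" by (intro integral_nonneg_AE) simp
    ultimately have "expectation (\<lambda>x. x\<^sup>2) = 0" by simp
    moreover have "integrable \<rho> (\<lambda>x. x\<^sup>2)"
    proof (rule square_integrable_imp_integrable)
      show "integrable \<rho> (\<lambda>x. (x\<^sup>2)\<^sup>2)"
        by (rule square_integrable_imp_integrable) (use moment8 meas_pow[of 4] in \<open>simp_all\<close>)
    qed (rule meas_pow)
    ultimately have "AE x in \<rho>. x\<^sup>2 = 0" by (subst (asm) integral_nonneg_eq_0_iff_AE) auto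
    then have "AE x in \<rho>. x \<in> {0}" by simp
    then have "AE x in lborel. 0 < ennreal (f x) \<longrightarrow> x \<in> {0}"
      unfolding \<rho> by (subst (asm) AE_density) auto
    moreover have "AE x in lborel. x \<notin> {0::real}" by (rule AE_not_in) (simp add: countable_imp_null_set_lborel)
    ultimately have "AE x in lborel. ennreal (f x) = 0" by eventually_elim (auto simp: ennreal_neg not_less)
    then have "emeasure \<rho> (space \<rho>) = 0"
      unfolding \<rho> by (subst emeasure_density) (auto simp: nn_integral_0_iff_AE)
    then show False using emeasure_space_1 by simp
  qed
  with sets symmetric moment8 show ?thesis
    by (intro symmetric_law.intro prob symmetric_law_axioms.intro)
qed

theorem theorem2:
  fixes \<rho> :: "real measure" and f :: "real \<Rightarrow> real" and \<sigma> \<mu>\<^sub>4 :: real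
    and M :: "nat \<Rightarrow> 'a measure" and X :: "nat \<Rightarrow> nat \<Rightarrow> 'a \<Rightarrow> real"
  assumes "prob_space \<rho>"
    and "f \<in> borel_measurable borel" and "\<And>x. f x \<ge> 0"
    and "\<rho> = density lborel (\<lambda>x. ennreal (f x))"
    and "\<And>x. f (- x) = f x"
    and "\<exists>v\<^sub>0>0. (\<integral>\<^sup>+z. ennreal (exp (v\<^sub>0 * z\<^sup>2) * f z) \<partial>lborel) < \<infinity>"
    and "\<exists>p\<in>{1<..2}. (\<integral>\<^sup>+(x, y). ennreal (f (x + y) powr p * f y powr p * \<bar>x\<bar> powr (1 - p))
           \<partial>(lborel \<Otimes>\<^sub>M lborel)) < \<infinity>"
    and "\<sigma>\<^sup>2 = prob_space.variance \<rho> (\<lambda>x. x)"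
    and "\<mu>\<^sub>4 = prob_space.expectation \<rho> (\<lambda>x. x ^ 4)"
    and "\<And>n. n \<ge> 1 \<Longrightarrow> prob_space (M n)"
    and "\<And>n i. i < n \<Longrightarrow> X n i \<in> borel_measurable (M n)"
    and "\<And>n. n \<ge> 1 \<Longrightarrow>
           distr (M n) (\<Pi>\<^sub>M i\<in>{..<n}. borel) (\<lambda>\<omega>. \<lambda>i\<in>{..<n}. X n i \<omega>) = tilde_mu n \<rho>"
  shows "weak_conv_m
           (\<lambda>n. distr (M n) borel
              (\<lambda>\<omega>. \<mu>\<^sub>4 powr (1 / 4) * (\<Sum>i<n. X n i \<omega>) / (\<sigma>\<^sup>2 * real n powr (3 / 4))))
           (density lborel
              (\<lambda>s. ennreal ((4 / 3) powr (1 / 4) * inverse (Gamma (1 / 4)) * exp (- (s ^ 4) / 12))))"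
proof -
  obtain c where c: "c > 0" "(\<integral>\<^sup>+z. ennreal (exp (c * z\<^sup>2) * f z) \<partial>lborel) < \<infinity>"
    using assms(6) by blast
  interpret law: symmetric_law \<rho>
    by (rule symmetric_lawI[OF assms(1-5) c])
  have "law.expectation (\<lambda>x. x) = (\<integral>x. x \<partial>distr \<rho> borel uminus)" by (simp add: law.symmetric)
  also have "\<dots> = - law.expectation (\<lambda>x. x)"
    by (subst integral_distr) (simp_all add: measurable_cong_sets[OF law.sets_law refl])
  finally have "law.expectation (\<lambda>x. x) = 0" by simp
  then have \<sigma>: "\<sigma>\<^sup>2 = law.variance_law" by (simp add: assms(8) law.variance_law_def)
  have \<mu>: "\<mu>\<^sub>4 = law.fourth_moment" by (simp add: assms(9) law.fourth_moment_def)
  show ?thesis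
    unfolding \<sigma> \<mu> using law.self_normalised_limit[OF assms(10-12)] by (simp add: quartic_law_def)
qed

end
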